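(* Let $A,B,S,T$ be finite sets, $\Gamma=A\times B\times S\times T$, $P\in C_q(\Gamma)$ and $r\in\mathbb{N}$. If $\xi_r^{\mathrm{q}}(P)$ admits a $(\lceil r/3\rceil+1)$-flat optimal solution, then $\xi_r^{\mathrm{q}}(P)=\xi_*^{\mathrm{q}}(P)$.
   Context: Correlations. A correlation is $P=(P(a,b|s,t))\in\mathbb{R}^\Gamma$ with nonnegative entries and $\sum_{a,b}P(a,b|s,t)=1$ for all $(s,t)\in S\times T$. For $d\in\mathbb{N}$, $C_q^d(\Gamma)$ is the set of correlations $P(a,b|s,t)=\psi^*(E_s^a\otimes F_t^b)\psi$ with $\psi\in\mathbb{C}^d\otimes\mathbb{C}^d$ a unit vector and, for all $s\in S$, $t\in T$, $\{E_s^a\}_{a\in A}$, $\{F_t^b\}_{b\in B}$ families of $d\times d$ Hermitian positive semidefinite matrices summing to the identity; $C_q(\Gamma)=\bigcup_{d\in\mathbb{N}}C_q^d(\Gamma)$. Noncommutative polynomials. Let $\mathbf{x}=\{x_s^a:(a,s)\in A\times S\}$, $\mathbf{y}=\{y_t^b:(b,t)\in B\times T\}$, and let $z$ be one more symbol. For $m\in\mathbb{N}\cup\{\infty\}$, $\langle\mathbf{x},\mathbf{y},z\rangle_m$ is the set of words of length (degree) at most $m$ in these symbols and $\mathbb{R}\langle\mathbf{x},\mathbf{y},z\rangle_m$ is its real linear span (the subscript $\infty$ is omitted). The involution $*$ reverses words and fixes each symbol. For $r\in\mathbb{N}\cup\{\infty\}$, a linear functional $L\in\mathbb{R}\langle\mathbf{x},\mathbf{y},z\rangle_{2r}^*$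 is symmetric if $L(w)=L(w^* )$ for all words $w$ of degree at most $2r$, and tracial if $L(ww')=L(w'w)$ for all words $w,w'$ with $\deg(ww')\le 2r$. Its moment matrix $M_r(L)$ is indexed by words of degree at most $r$, with entries $M_r(L)_{w,w'}=L(w^*w')$; write $M(L)$ when $r=\infty$. Let $$\mathcal{G}=\{x_s^a:s\in S,a\in A\}\cup\{y_t^b:t\in T,b\in B\}\cup\{z\},$$ $$\mathcal{H}=\{z-z^2\}\cup\Big\{1-\sum_{a\in A}x_s^a:s\in S\Big\}\cup\Big\{1-\sum_{b\in B}y_t^b:t\in T\Big\}\cup\{x_s^ay_t^b-y_t^bx_s^a:(a,b,s,t)\in\Gamma\},$$ $$\mathcal{R}_r=\{zuzvz-zvzuz:u,v\in\langle\mathbf{x},\mathbf{y},z\rangle,\ \deg(zuzvz)\le 2r\}.$$ Let $\mathcal{M}_{2r}(\mathcal{G})$ be the convex cone generated by all $p^*gp$ with $p\in\mathbb{R}\langle\mathbf{x},\mathbf{y},z\rangle$, $g\in\mathcal{G}\cup\{1\}$, $\deg(p^*gp)\le 2r$, and let $\mathcal{I}_{2r}(\mathcal{H}\cup\mathcal{R}_r)=\{ph:p\in\mathbb{R}\langle\mathbf{x},\mathbf{y},z\rangle,\ h\in\mathcal{H}\cup\mathcal{R}_r,\ \deg(ph)\le 2r\}$. (For $r=\infty$ there are no degree restrictions.) For $r\in\mathbb{N}\cup\{\infty\}$, $\xi_r^{\mathrm{q}}(P)$ is the minimum of $L(1)$ over all tracial symmetric $L\in\mathbb{R}\langle\mathbf{x},\mathbf{y},z\rangle_{2r}^*$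 such that $L(z)=1$, $L(x_s^ay_t^bz)=P(a,b|s,t)$ for all $(a,b,s,t)\in\Gamma$ (a constraint to be omitted when $r=1$, since it then exceeds the degree bound), $L\ge0$ on $\mathcal{M}_{2r}(\mathcal{G})$, and $L=0$ on $\mathcal{I}_{2r}(\mathcal{H}\cup\mathcal{R}_r)$. The parameter $\xi_*^{\mathrm{q}}(P)$ is defined by adding the constraint $\operatorname{rank}(M(L))<\infty$ to the program defining $\xi_\infty^{\mathrm{q}}(P)$. For integers $1\le\delta\le r<\infty$, $L\in\mathbb{R}\langle\mathbf{x},\mathbf{y},z\rangle_{2r}^*$ is $\delta$-flat if the principal submatrix $M_{r-\delta}(L)$ of $M_r(L)$, indexed by words of degree at most $r-\delta$, has the same rank as $M_r(L)$. A $\delta$-flat optimal solution of $\xi_r^{\mathrm{q}}(P)$ is a feasible $L$ attaining the minimum that is $\delta$-flat (in particular $\delta\le r$ is required). *)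

theory Defs
  imports
    "HOL-Analysis.Analysis"
    "HOL-Library.Poly_Mapping"
    "HOL-Library.Function_Algebras"
    "Jordan_Normal_Form.Schur_Decomposition"
begin

section \<open>Quantum correlations\<close>

text \<open>A correlation \<open>P(a,b|s,t)\<close> is written \<open>P a b s t\<close>; its values outside
  \<open>A \<times> B \<times> S \<times> T\<close> are irrelevant.\<close>

definition correlation ::
  "'a set \<Rightarrow> 'b set \<Rightarrow> 's set \<Rightarrow> 't set \<Rightarrow> ('a \<Rightarrow> 'b \<Rightarrow> 's \<Rightarrow> 't \<Rightarrow> real) \<Rightarrow> bool" where
  "correlation A B S T P \<longleftrightarrow>
     (\<forall>a\<in>A. \<forall>b\<in>B. \<forall>s\<in>S. \<forall>t\<in>T. 0 \<le> P a b s t) \<and>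
     (\<forall>s\<in>S. \<forall>t\<in>T. (\<Sum>a\<in>A. \<Sum>b\<in>B. P a b s t) = 1)"

definition hermitian_psd :: "nat \<Rightarrow> complex mat \<Rightarrow> bool" where
  "hermitian_psd d M \<longleftrightarrow> M \<in> carrier_mat d d \<and> mat_adjoint M = M \<and>
     (\<forall>v\<in>carrier_vec d. 0 \<le> Re ((M *\<^sub>v v) \<bullet>c v))"

definition povm :: "nat \<Rightarrow> 'i set \<Rightarrow> ('i \<Rightarrow> complex mat) \<Rightarrow> bool" where
  "povm d I E \<longleftrightarrow> (\<forall>i\<in>I. hermitian_psd d (E i)) \<and>
     mat d d (\<lambda>kl. \<Sum>i\<in>I. E i $$ kl) = 1\<^sub>m d"

definition kronecker :: "complex mat \<Rightarrow> complex mat \<Rightarrow> complex mat" (infixl \<open>\<otimes>\<^sub>K\<close> 70) where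
  "E \<otimes>\<^sub>K F = mat (dim_row E * dim_row F) (dim_col E * dim_col F)
     (\<lambda>(i, j). E $$ (i div dim_row F, j div dim_col F) * F $$ (i mod dim_row F, j mod dim_col F))"

text \<open>\<open>\<complex>\<^sup>d \<otimes> \<complex>\<^sup>d\<close> is identified with \<open>\<complex>\<close>-vectors of length \<open>d * d\<close>, in the index order of
  \<^const>\<open>kronecker\<close>. Since \<open>u \<bullet>c v\<close> conjugates its second argument,
  \<open>\<psi>\<^sup>* M \<psi>\<close> is \<open>(M *\<^sub>v \<psi>) \<bullet>c \<psi>\<close>.\<close>

definition C_q_dim ::
  "'a set \<Rightarrow> 'b set \<Rightarrow> 's set \<Rightarrow> 't set \<Rightarrow> nat \<Rightarrow> ('a \<Rightarrow> 'b \<Rightarrow> 's \<Rightarrow> 't \<Rightarrow> real) set" where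
  "C_q_dim A B S T d = {P. correlation A B S T P \<and>
     (\<exists>\<psi> E F. \<psi> \<in> carrier_vec (d * d) \<and> \<psi> \<bullet>c \<psi> = 1 \<and>
        (\<forall>s\<in>S. povm d A (E s)) \<and> (\<forall>t\<in>T. povm d B (F t)) \<and>
        (\<forall>a\<in>A. \<forall>b\<in>B. \<forall>s\<in>S. \<forall>t\<in>T.
           complex_of_real (P a b s t) = ((E s a \<otimes>\<^sub>K F t b) *\<^sub>v \<psi>) \<bullet>c \<psi>))}"

definition C_q ::
  "'a set \<Rightarrow> 'b set \<Rightarrow> 's set \<Rightarrow> 't set \<Rightarrow> ('a \<Rightarrow> 'b \<Rightarrow> 's \<Rightarrow> 't \<Rightarrow> real) set" where
  "C_q A B S T = (\<Union>d. C_q_dim A B S T d)"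


section \<open>Noncommutative polynomials\<close>

text \<open>With concatenation as the monoid operation on words, the type of finitely supported
  functions \<open>'g list \<Rightarrow>\<^sub>0 real\<close> with its convolution product is the free real algebra
  over \<open>'g\<close>.\<close>

instantiation list :: (type) monoid_add
begin
definition zero_list :: "'a list" where "zero_list = []"
definition plus_list :: "'a list \<Rightarrow> 'a list \<Rightarrow> 'a list" where "plus_list = (@)"
instance by standard (simp_all add: zero_list_def plus_list_def)
end

instantiation poly_mapping :: (type, real_vector) real_vector
begin
lift_definition scaleR_poly_mapping :: "real \<Rightarrow> ('a \<Rightarrow>\<^sub>0 'b) \<Rightarrow> ('a \<Rightarrow>\<^sub>0 'b)"
  is "\<lambda>c f x. c *\<^sub>R f x"
  by (erule finite_subset[rotated]) auto
instance
  by standard (transfer; simp add: scaleR_add_right scaleR_add_left)+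
end

type_synonym 'g ncpoly = "'g list \<Rightarrow>\<^sub>0 real"

abbreviation mon :: "'g list \<Rightarrow> 'g ncpoly" where
  "mon w \<equiv> Poly_Mapping.single w 1"

definition words :: "'g set \<Rightarrow> enat \<Rightarrow> 'g list set" where
  "words V m = {w. set w \<subseteq> V \<and> enat (length w) \<le> m}"

text \<open>Polynomials in the symbols \<open>V\<close> of degree at most \<open>m\<close>.\<close>

definition ncpolys :: "'g set \<Rightarrow> enat \<Rightarrow> 'g ncpoly set" where
  "ncpolys V m = {p. Poly_Mapping.keys p \<subseteq> words V m}"

text \<open>The involution; the coefficient of \<open>w\<close> in \<open>p\<^sup>*\<close> is that of \<open>rev w\<close> in \<open>p\<close>.\<close>

definition ncstar :: "'g ncpoly \<Rightarrow> 'g ncpoly" where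
  "ncstar p = Poly_Mapping.map_key rev p"

text \<open>An element of the dual of \<open>ncpolys V m\<close> is represented by a function on all polynomials;
  only its restriction to \<open>ncpolys V m\<close> matters.\<close>

definition linear_functional_on :: "'g ncpoly set \<Rightarrow> ('g ncpoly \<Rightarrow> real) \<Rightarrow> bool" where
  "linear_functional_on U L \<longleftrightarrow>
     (\<forall>p\<in>U. \<forall>q\<in>U. L (p + q) = L p + L q) \<and> (\<forall>c. \<forall>p\<in>U. L (c *\<^sub>R p) = c * L p)"

definition symmetric_functional :: "'g set \<Rightarrow> enat \<Rightarrow> ('g ncpoly \<Rightarrow> real) \<Rightarrow> bool" where
  "symmetric_functional V m L \<longleftrightarrow> (\<forall>w\<in>words V m. L (mon w) = L (mon (rev w)))"

definition tracial_functional :: "'g set \<Rightarrow> enat \<Rightarrow> ('g ncpoly \<Rightarrow> real) \<Rightarrow> bool" where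
  "tracial_functional V m L \<longleftrightarrow>
     (\<forall>w w'. w @ w' \<in> words V m \<longrightarrow> L (mon (w @ w')) = L (mon (w' @ w)))"


section \<open>Moment matrices and flatness\<close>

instantiation "fun" :: (type, real_vector) real_vector
begin
definition scaleR_fun :: "real \<Rightarrow> ('a \<Rightarrow> 'b) \<Rightarrow> 'a \<Rightarrow> 'b" where
  "scaleR_fun c f = (\<lambda>x. c *\<^sub>R f x)"
instance
  by standard (simp_all add: scaleR_fun_def fun_eq_iff scaleR_add_right scaleR_add_left)
end

text \<open>The rank (dimension of the column space, possibly infinite) of a real matrix with rows
  indexed by \<open>I\<close> and columns indexed by \<open>J\<close>. The case distinction is needed because
  \<^const>\<open>dim\<close> returns \<open>0\<close> on infinite-dimensional sets.\<close>

definition matrix_columns :: "'i set \<Rightarrow> 'j set \<Rightarrow> ('i \<Rightarrow> 'j \<Rightarrow> real) \<Rightarrow> ('i \<Rightarrow> real) set" where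
  "matrix_columns I J M = (\<lambda>j i. if i \<in> I then M i j else 0) ` J"

definition matrix_rank :: "'i set \<Rightarrow> 'j set \<Rightarrow> ('i \<Rightarrow> 'j \<Rightarrow> real) \<Rightarrow> enat" where
  "matrix_rank I J M =
     (if \<exists>C. finite C \<and> matrix_columns I J M \<subseteq> span C
      then enat (dim (matrix_columns I J M)) else \<infinity>)"

definition moment_matrix :: "('g ncpoly \<Rightarrow> real) \<Rightarrow> 'g list \<Rightarrow> 'g list \<Rightarrow> real" where
  "moment_matrix L w w' = L (mon (rev w @ w'))"

definition moment_rank :: "'g set \<Rightarrow> enat \<Rightarrow> ('g ncpoly \<Rightarrow> real) \<Rightarrow> enat" where
  "moment_rank V r L = matrix_rank (words V r) (words V r) (moment_matrix L)"

definition delta_flat :: "'g set \<Rightarrow> nat \<Rightarrow> nat \<Rightarrow> ('g ncpoly \<Rightarrow> real) \<Rightarrow> bool" where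
  "delta_flat V r \<delta> L \<longleftrightarrow> 1 \<le> \<delta> \<and> \<delta> \<le> r \<and>
     moment_rank V (enat (r - \<delta>)) L = moment_rank V (enat r) L"


section \<open>The optimization programs\<close>

text \<open>\<open>X s a\<close>, \<open>Y t b\<close> and \<open>Z\<close> stand for \<open>x\<^sub>s\<^sup>a\<close>, \<open>y\<^sub>t\<^sup>b\<close> and \<open>z\<close>.\<close>

datatype ('a, 'b, 's, 't) symb = X 's 'a | Y 't 'b | Z

definition symbols :: "'a set \<Rightarrow> 'b set \<Rightarrow> 's set \<Rightarrow> 't set \<Rightarrow> ('a, 'b, 's, 't) symb set" where
  "symbols A B S T = {X s a | s a. s \<in> S \<and> a \<in> A} \<union> {Y t b | t b. t \<in> T \<and> b \<in> B} \<union> {Z}"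

definition set_G :: "'a set \<Rightarrow> 'b set \<Rightarrow> 's set \<Rightarrow> 't set \<Rightarrow> ('a, 'b, 's, 't) symb ncpoly set" where
  "set_G A B S T = {mon [v] | v. v \<in> symbols A B S T}"

definition set_H :: "'a set \<Rightarrow> 'b set \<Rightarrow> 's set \<Rightarrow> 't set \<Rightarrow> ('a, 'b, 's, 't) symb ncpoly set" where
  "set_H A B S T =
     {mon [Z] - mon [Z] * mon [Z]} \<union>
     {1 - (\<Sum>a\<in>A. mon [X s a]) | s. s \<in> S} \<union>
     {1 - (\<Sum>b\<in>B. mon [Y t b]) | t. t \<in> T} \<union>
     {mon [X s a] * mon [Y t b] - mon [Y t b] * mon [X s a] | a b s t.
        a \<in> A \<and> b \<in> B \<and> s \<in> S \<and> t \<in> T}"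

definition set_R ::
  "'a set \<Rightarrow> 'b set \<Rightarrow> 's set \<Rightarrow> 't set \<Rightarrow> enat \<Rightarrow> ('a, 'b, 's, 't) symb ncpoly set" where
  "set_R A B S T r =
     {mon ([Z] @ u @ [Z] @ v @ [Z]) - mon ([Z] @ v @ [Z] @ u @ [Z]) | u v.
        u \<in> words (symbols A B S T) \<infinity> \<and> v \<in> words (symbols A B S T) \<infinity> \<and>
        enat (length ([Z] @ u @ [Z] @ v @ [Z] :: ('a, 'b, 's, 't) symb list)) \<le> 2 * r}"

text \<open>\<open>\<M>\<^sub>m(G)\<close> and \<open>\<I>\<^sub>m(H)\<close> in the symbols \<open>V\<close>, with degree bound \<open>m\<close>.\<close>

definition quad_module :: "'g set \<Rightarrow> enat \<Rightarrow> 'g ncpoly set \<Rightarrow> 'g ncpoly set" where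
  "quad_module V m G = convex_cone hull
     {ncstar p * g * p | p g. p \<in> ncpolys V \<infinity> \<and> g \<in> G \<union> {1} \<and> ncstar p * g * p \<in> ncpolys V m}"

definition trunc_ideal :: "'g set \<Rightarrow> enat \<Rightarrow> 'g ncpoly set \<Rightarrow> 'g ncpoly set" where
  "trunc_ideal V m H = {p * h | p h. p \<in> ncpolys V \<infinity> \<and> h \<in> H \<and> p * h \<in> ncpolys V m}"

definition xi_q_feasible ::
  "'a set \<Rightarrow> 'b set \<Rightarrow> 's set \<Rightarrow> 't set \<Rightarrow> ('a \<Rightarrow> 'b \<Rightarrow> 's \<Rightarrow> 't \<Rightarrow> real) \<Rightarrow> enat \<Rightarrow>
   (('a, 'b, 's, 't) symb ncpoly \<Rightarrow> real) \<Rightarrow> bool" where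
  "xi_q_feasible A B S T P r L \<longleftrightarrow>
     linear_functional_on (ncpolys (symbols A B S T) (2 * r)) L \<and>
     symmetric_functional (symbols A B S T) (2 * r) L \<and>
     tracial_functional (symbols A B S T) (2 * r) L \<and>
     L (mon [Z]) = 1 \<and>
     (3 \<le> 2 * r \<longrightarrow>
        (\<forall>a\<in>A. \<forall>b\<in>B. \<forall>s\<in>S. \<forall>t\<in>T. L (mon [X s a, Y t b, Z]) = P a b s t)) \<and>
     (\<forall>p\<in>quad_module (symbols A B S T) (2 * r) (set_G A B S T). 0 \<le> L p) \<and>
     (\<forall>p\<in>trunc_ideal (symbols A B S T) (2 * r) (set_H A B S T \<union> set_R A B S T r). L p = 0)"

definition xi_q_star_feasible ::
  "'a set \<Rightarrow> 'b set \<Rightarrow> 's set \<Rightarrow> 't set \<Rightarrow> ('a \<Rightarrow> 'b \<Rightarrow> 's \<Rightarrow> 't \<Rightarrow> real) \<Rightarrow>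
   (('a, 'b, 's, 't) symb ncpoly \<Rightarrow> real) \<Rightarrow> bool" where
  "xi_q_star_feasible A B S T P L \<longleftrightarrow>
     xi_q_feasible A B S T P \<infinity> L \<and> moment_rank (symbols A B S T) \<infinity> L < \<infinity>"

text \<open>Optimal values are extended reals, with value \<open>\<infinity>\<close> for an infeasible program;
  the infimum is the minimum whenever the latter exists.\<close>

definition xi_q ::
  "'a set \<Rightarrow> 'b set \<Rightarrow> 's set \<Rightarrow> 't set \<Rightarrow> ('a \<Rightarrow> 'b \<Rightarrow> 's \<Rightarrow> 't \<Rightarrow> real) \<Rightarrow> enat \<Rightarrow> ereal" where
  "xi_q A B S T P r = (INF L \<in> {L. xi_q_feasible A B S T P r L}. ereal (L 1))"

definition xi_q_star ::
  "'a set \<Rightarrow> 'b set \<Rightarrow> 's set \<Rightarrow> 't set \<Rightarrow> ('a \<Rightarrow> 'b \<Rightarrow> 's \<Rightarrow> 't \<Rightarrow> real) \<Rightarrow> ereal" where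
  "xi_q_star A B S T P = (INF L \<in> {L. xi_q_star_feasible A B S T P L}. ereal (L 1))"

definition flat_optimal ::
  "'a set \<Rightarrow> 'b set \<Rightarrow> 's set \<Rightarrow> 't set \<Rightarrow> ('a \<Rightarrow> 'b \<Rightarrow> 's \<Rightarrow> 't \<Rightarrow> real) \<Rightarrow> nat \<Rightarrow> nat \<Rightarrow>
   (('a, 'b, 's, 't) symb ncpoly \<Rightarrow> real) \<Rightarrow> bool" where
  "flat_optimal A B S T P r \<delta> L \<longleftrightarrow>
     xi_q_feasible A B S T P (enat r) L \<and>
     (\<forall>L'. xi_q_feasible A B S T P (enat r) L' \<longrightarrow> L 1 \<le> L' 1) \<and>
     delta_flat (symbols A B S T) r \<delta> L"

end

theory Submission
  imports Defs
begin

text \<open>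
  Let \<open>L\<close> be \<open>\<delta>\<close>-flat of order \<open>r\<close>, put \<open>d = r - \<delta>\<close>, and let \<open>N\<close> be the kernel of its moment matrix.
  Flatness says that modulo \<open>N\<close> every polynomial of degree at most \<open>r\<close> is one of degree at most \<open>d\<close>.
  Multiplying by one symbol and reducing again gives a normal form of degree at most \<open>d\<close> for every
  word. Traciality makes \<open>N\<close> a left and a right kernel, and since \<open>\<delta> \<ge> 2\<close> left and right
  multiplication commute modulo \<open>N\<close>; so the polynomials with normal form in \<open>N\<close> are a
  two-sided ideal. Hence \<open>L\<close> composed with the normal form extends \<open>L\<close> to a tracial functional
  of finite rank, and each constraint can be tested on normal forms. The longest one,
  \<open>p (z u z v z - z v z u z)\<close>, then has degree at most \<open>3 d + 3\<close>, which is at most \<open>2 r\<close> exactly when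
  \<open>\<delta> \<ge> r/3 + 1\<close>.
\<close>

section \<open>The free algebra as a vector space\<close>

abbreviation linear_subspace :: "'v::real_vector set \<Rightarrow> bool" where
  "linear_subspace \<equiv> Real_Vector_Spaces.subspace"

lemma linear_subspaceI:
  assumes "0 \<in> U" "\<And>x y. x \<in> U \<Longrightarrow> y \<in> U \<Longrightarrow> x + y \<in> U" "\<And>c x. x \<in> U \<Longrightarrow> c *\<^sub>R x \<in> U"
  shows "linear_subspace U"
  using assms by (simp add: real_vector.subspace_def)

lemma scaleR_single: "c *\<^sub>R Poly_Mapping.single k x = Poly_Mapping.single k (c *\<^sub>R x)"
  by (rule poly_mapping_eqI) (simp add: scaleR_poly_mapping.rep_eq lookup_single when_def)

lemma poly_mapping_sum_single:
  "p = (\<Sum>k\<in>Poly_Mapping.keys p. Poly_Mapping.single k (Poly_Mapping.lookup p k))"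
proof (rule poly_mapping_eqI)
  fix k
  show "Poly_Mapping.lookup p k =
    Poly_Mapping.lookup (\<Sum>k\<in>Poly_Mapping.keys p. Poly_Mapping.single k (Poly_Mapping.lookup p k)) k"
    by (cases "k \<in> Poly_Mapping.keys p")
      (auto simp: lookup_sum lookup_single when_def in_keys_iff)
qed

lemma ncpoly_sum_mon:
  "p = (\<Sum>w\<in>Poly_Mapping.keys p. Poly_Mapping.lookup p w *\<^sub>R mon w)"
  using poly_mapping_sum_single[of p] by (simp add: scaleR_single)

text \<open>Makes multiplication by a fixed polynomial \<open>linear\<close>. Both factors are
  expanded into single terms, so the scalar laws are needed only for products of two such
  terms.\<close>

instance poly_mapping :: (monoid_add, real_algebra) real_algebra
proof
  fix a :: real and x y :: "'a \<Rightarrow>\<^sub>0 'b"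
  have single: "a *\<^sub>R Poly_Mapping.single k c * Poly_Mapping.single l c' =
      a *\<^sub>R (Poly_Mapping.single k c * Poly_Mapping.single l c')"
    "Poly_Mapping.single k c * a *\<^sub>R Poly_Mapping.single l c' =
      a *\<^sub>R (Poly_Mapping.single k c * Poly_Mapping.single l c')" for k l :: 'a and c c' :: 'b
    by (simp_all add: scaleR_single mult_single)
  show "a *\<^sub>R x * y = a *\<^sub>R (x * y)"
    by (subst (1 2) poly_mapping_sum_single[of x], subst (1 2) poly_mapping_sum_single[of y])
      (simp add: sum_product scaleR_sum_right single)
  show "x * a *\<^sub>R y = a *\<^sub>R (x * y)"
    by (subst (1 2) poly_mapping_sum_single[of x], subst (1 2) poly_mapping_sum_single[of y])
      (simp add: sum_product scaleR_sum_right single)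
qed

lemma linear_mult_left: "linear (\<lambda>x :: 'v::real_algebra. a * x)"
  by (rule linearI) (simp_all add: distrib_left)

lemma linear_mult_right: "linear (\<lambda>x :: 'v::real_algebra. x * a)"
  by (rule linearI) (simp_all add: distrib_right)

lemma mon_mult: "mon u * mon v = mon (u @ v)"
  by (simp add: mult_single plus_list_def)

lemma mon_Nil: "mon [] = 1"
  by (metis single_one zero_list_def)

lemma mon_Cons: "mon (v # w) = mon [v] * mon w"
  by (simp add: mon_mult)

lemma words_enat_iff: "w \<in> words V (enat m) \<longleftrightarrow> set w \<subseteq> V \<and> length w \<le> m"
  by (simp add: words_def)

lemma words_infinity_iff: "w \<in> words V \<infinity> \<longleftrightarrow> set w \<subseteq> V"
  by (simp add: words_def)

lemma finite_words: "finite V \<Longrightarrow> finite (words V (enat m))"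
  by (simp add: words_def finite_lists_length_le)

lemma ncpolys_subspace: "linear_subspace (ncpolys V m)"
proof (rule linear_subspaceI)
  show "p + q \<in> ncpolys V m" if "p \<in> ncpolys V m" "q \<in> ncpolys V m" for p q
    using that keys_add[of p q] by (auto simp: ncpolys_def)
  show "c *\<^sub>R p \<in> ncpolys V m" if "p \<in> ncpolys V m" for c p
    using that by (auto simp: ncpolys_def in_keys_iff scaleR_poly_mapping.rep_eq)
qed (simp add: ncpolys_def)

lemma mon_in_ncpolys_iff: "mon w \<in> ncpolys V m \<longleftrightarrow> w \<in> words V m"
  by (simp add: ncpolys_def)

text \<open>Because of this, membership in a subspace and equality of linear maps need checking on
  words only.\<close>

lemma ncpolys_eq_span: "ncpolys V m = span (mon ` words V m)"
proof
  show "ncpolys V m \<subseteq> span (mon ` words V m)"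
  proof
    fix p assume "p \<in> ncpolys V m"
    then have "(\<Sum>w\<in>Poly_Mapping.keys p. Poly_Mapping.lookup p w *\<^sub>R mon w) \<in> span (mon ` words V m)"
      by (intro span_sum span_scale span_base) (auto simp: ncpolys_def)
    then show "p \<in> span (mon ` words V m)"
      by (simp flip: ncpoly_sum_mon)
  qed
  show "span (mon ` words V m) \<subseteq> ncpolys V m"
    by (rule span_minimal) (auto simp: mon_in_ncpolys_iff ncpolys_subspace)
qed

lemmas ncpolys_simps =
  real_vector.subspace_0[OF ncpolys_subspace]
  real_vector.subspace_add[OF ncpolys_subspace]
  real_vector.subspace_diff[OF ncpolys_subspace]
  real_vector.subspace_scale[OF ncpolys_subspace]
  real_vector.subspace_sum[OF ncpolys_subspace]

lemma ncpolys_subset_subspace: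
  assumes "linear_subspace U" "\<And>w. w \<in> words V m \<Longrightarrow> mon w \<in> U"
  shows "ncpolys V m \<subseteq> U"
  unfolding ncpolys_eq_span by (rule span_minimal) (use assms in auto)

lemma linear_eq_on_ncpolys:
  assumes "linear f" "linear g" "\<And>w. w \<in> words V m \<Longrightarrow> f (mon w) = g (mon w)"
    and "p \<in> ncpolys V m"
  shows "f p = g p"
  using linear_eq_on_span[of f g "mon ` words V m" p] assms by (auto simp: ncpolys_eq_span)

lemma words_mono: "m \<le> n \<Longrightarrow> words V m \<subseteq> words V n"
  by (auto simp: words_def)

lemma ncpolys_mono: "m \<le> n \<Longrightarrow> ncpolys V m \<subseteq> ncpolys V n"
  using words_mono by (fastforce simp: ncpolys_def)

lemma linear_preimage_subspace:
  assumes "linear f" "linear_subspace U"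
  shows "linear_subspace {x. f x \<in> U}"
  using assms by (intro linear_subspaceI)
    (simp_all add: linear_0 linear_add linear_scale real_vector.subspace_0
      real_vector.subspace_add real_vector.subspace_scale)

lemma ncpolys_mult:
  assumes "p \<in> ncpolys V m" "q \<in> ncpolys V n"
  shows "p * q \<in> ncpolys V (m + n)"
proof -
  have "set (u @ v) \<subseteq> V \<and> enat (length (u @ v)) \<le> m + n"
    if "u \<in> words V m" "v \<in> words V n" for u v
    using that add_mono[of "enat (length u)" m "enat (length v)" n] by (auto simp: words_def)
  then have words: "mon u * mon v \<in> ncpolys V (m + n)" if "u \<in> words V m" "v \<in> words V n" for u v
    using that by (simp add: mon_mult mon_in_ncpolys_iff words_def)
  have "ncpolys V n \<subseteq> {x. mon u * x \<in> ncpolys V (m + n)}" if "u \<in> words V m" for u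
    by (rule ncpolys_subset_subspace)
      (use that words in \<open>auto intro: linear_preimage_subspace linear_mult_left ncpolys_subspace\<close>)
  then have "ncpolys V m \<subseteq> {x. x * q \<in> ncpolys V (m + n)}"
    by (intro ncpolys_subset_subspace)
      (use assms(2) in \<open>auto intro: linear_preimage_subspace linear_mult_right ncpolys_subspace\<close>)
  then show ?thesis
    using assms(1) by auto
qed

lemma ncpolys_mult_enat:
  assumes "p \<in> ncpolys V (enat m)" "q \<in> ncpolys V (enat n)" "m + n \<le> k"
  shows "p * q \<in> ncpolys V (enat k)"
  using ncpolys_mult[OF assms(1,2)] ncpolys_mono[of "enat m + enat n" "enat k" V] assms(3) by auto

lemma ncpolys_mult_infinity:
  assumes "p \<in> ncpolys V \<infinity>" "q \<in> ncpolys V \<infinity>"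
  shows "p * q \<in> ncpolys V \<infinity>"
  using ncpolys_mult[OF assms] by simp

lemma ncpolys_infinity: "p \<in> ncpolys V m \<Longrightarrow> p \<in> ncpolys V \<infinity>"
  using ncpolys_mono[of m \<infinity>] by auto

lemma ncpolys_enat_mono: "p \<in> ncpolys V (enat m) \<Longrightarrow> m \<le> n \<Longrightarrow> p \<in> ncpolys V (enat n)"
  using ncpolys_mono[of "enat m" "enat n"] by auto

lemma one_in_ncpolys: "1 \<in> ncpolys V (enat m)"
  by (simp add: mon_in_ncpolys_iff words_enat_iff flip: mon_Nil)

section \<open>The involution\<close>

lemma linear_ncstar: "linear ncstar"
proof (rule linearI)
  have inj: "inj (rev :: 'a list \<Rightarrow> _)" by (simp add: inj_on_def)
  show "ncstar (p + q) = ncstar p + ncstar q" for p q :: "'a ncpoly"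
    by (simp add: ncstar_def map_key_plus inj)
  show "ncstar (c *\<^sub>R p) = c *\<^sub>R ncstar p" for c and p :: "'a ncpoly"
    by (rule poly_mapping_eqI) (simp add: ncstar_def map_key.rep_eq inj scaleR_poly_mapping.rep_eq)
qed

lemma ncstar_mon: "ncstar (mon w) = mon (rev w)"
  unfolding ncstar_def using map_key_single[of rev "rev w" "1::real"] by (simp add: inj_on_def)

lemma ncstar_in_ncpolys:
  assumes "p \<in> ncpolys V m"
  shows "ncstar p \<in> ncpolys V m"
proof -
  have "ncpolys V m \<subseteq> {p. ncstar p \<in> ncpolys V m}"
    by (rule ncpolys_subset_subspace)
      (auto intro: linear_preimage_subspace linear_ncstar ncpolys_subspace
        simp: ncstar_mon mon_in_ncpolys_iff words_def)
  then show ?thesis using assms by auto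
qed

text \<open>With all symbols and no degree bound, \<open>linear_eq_on_ncpolys\<close> proves
  identities of linear maps on the whole algebra.\<close>

lemma ncpoly_in_UNIV: "p \<in> ncpolys UNIV \<infinity>"
  by (simp add: ncpolys_def words_def)

lemma ncstar_mult: "ncstar (p * q) = ncstar q * ncstar p"
proof -
  have *: "ncstar (mon u * q) = ncstar q * ncstar (mon u)" for u
    by (rule linear_eq_on_ncpolys[OF _ _ _ ncpoly_in_UNIV,
          OF linear_compose[OF linear_mult_left linear_ncstar, unfolded o_def]
             linear_compose[OF linear_ncstar linear_mult_right, unfolded o_def]])
      (simp add: mon_mult ncstar_mon)
  show ?thesis
    by (rule linear_eq_on_ncpolys[OF _ _ _ ncpoly_in_UNIV,
          OF linear_compose[OF linear_mult_right linear_ncstar, unfolded o_def]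
             linear_compose[OF linear_ncstar linear_mult_left, unfolded o_def]])
      (rule *)
qed

lemma ncstar_ncstar: "ncstar (ncstar p) = p"
  by (rule linear_eq_on_ncpolys[OF _ _ _ ncpoly_in_UNIV,
        OF linear_compose[OF linear_ncstar linear_ncstar, unfolded o_def] linear_id[unfolded id_def]])
    (simp add: ncstar_mon)

text \<open>Serves two purposes: to carry normal forms from words to polynomials, and to replace a
  functional that is linear only up to some degree by one that is linear everywhere.\<close>

definition lin_ext :: "('g list \<Rightarrow> 'v::real_vector) \<Rightarrow> 'g ncpoly \<Rightarrow> 'v" where
  "lin_ext f p = (\<Sum>w\<in>Poly_Mapping.keys p. Poly_Mapping.lookup p w *\<^sub>R f w)"

lemma lin_ext_superset:
  assumes "finite K" "Poly_Mapping.keys p \<subseteq> K"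
  shows "lin_ext f p = (\<Sum>w\<in>K. Poly_Mapping.lookup p w *\<^sub>R f w)"
  unfolding lin_ext_def
  by (rule sum.mono_neutral_left) (use assms in \<open>auto simp: in_keys_iff\<close>)

lemma linear_lin_ext: "linear (lin_ext f)"
proof (rule linearI)
  fix p q :: "'a ncpoly" and c :: real
  let ?K = "Poly_Mapping.keys p \<union> Poly_Mapping.keys q"
  show "lin_ext f (p + q) = lin_ext f p + lin_ext f q"
    using keys_add[of p q]
    by (simp add: lin_ext_superset[of ?K] lookup_add scaleR_left_distrib sum.distrib)
  have "Poly_Mapping.keys (c *\<^sub>R p) \<subseteq> Poly_Mapping.keys p"
    by (auto simp: in_keys_iff scaleR_poly_mapping.rep_eq)
  then show "lin_ext f (c *\<^sub>R p) = c *\<^sub>R lin_ext f p"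
    by (simp add: lin_ext_superset[of "Poly_Mapping.keys p"] scaleR_poly_mapping.rep_eq
        scaleR_sum_right)
qed

lemma lin_ext_mon: "lin_ext f (mon w) = f w"
  by (simp add: lin_ext_def)

lemma linear_functional_on_sum:
  assumes "linear_functional_on (ncpolys V m) L" "finite K" "\<And>k. k \<in> K \<Longrightarrow> g k \<in> ncpolys V m"
  shows "L (\<Sum>k\<in>K. g k) = (\<Sum>k\<in>K. L (g k))"
  using assms(2,3)
proof (induction K)
  case empty
  have "L (0 *\<^sub>R 0) = 0 * L 0"
    using assms(1) ncpolys_simps(1) unfolding linear_functional_on_def by blast
  then show ?case by simp
next
  case (insert x F)
  then show ?case
    using assms(1) by (simp add: linear_functional_on_def ncpolys_simps)
qed

lemma lin_ext_functional:
  assumes L: "linear_functional_on (ncpolys V m) L" and p: "p \<in> ncpolys V m"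
  shows "lin_ext (\<lambda>w. L (mon w)) p = L p"
proof -
  have mon: "mon w \<in> ncpolys V m" if "w \<in> Poly_Mapping.keys p" for w
    using p that by (auto simp: ncpolys_def)
  have "L (\<Sum>w\<in>Poly_Mapping.keys p. Poly_Mapping.lookup p w *\<^sub>R mon w) =
      (\<Sum>w\<in>Poly_Mapping.keys p. L (Poly_Mapping.lookup p w *\<^sub>R mon w))"
    by (rule linear_functional_on_sum[OF L]) (simp_all add: mon ncpolys_simps)
  also have "\<dots> = lin_ext (\<lambda>w. L (mon w)) p"
    unfolding lin_ext_def
    by (rule sum.cong) (use L mon in \<open>auto simp: linear_functional_on_def\<close>)
  finally show ?thesis
    by (simp flip: ncpoly_sum_mon)
qed


section \<open>Flat extensions of tracial functionals\<close>

text \<open>Restriction to the rows in \<open>I\<close> maps the columns indexed by \<open>I\<close>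
  onto those of the small block. So these columns already span a space of dimension at least the
  rank of the block, which is the rank of the whole matrix.\<close>

lemma column_span_eq_if_rank_eq:
  fixes M :: "'i \<Rightarrow> 'i \<Rightarrow> real"
  assumes sub: "I \<subseteq> J" and fin: "finite J"
    and rank: "matrix_rank I I M = matrix_rank J J M"
  shows "matrix_columns J J M \<subseteq> span (matrix_columns J I M)"
proof -
  define res where "res = (\<lambda>f :: 'i \<Rightarrow> real. \<lambda>i. if i \<in> I then f i else 0)"
  have lin_res: "linear res"
    by (rule linearI) (auto simp: res_def scaleR_fun_def)
  have "finite I"
    using sub fin by (rule finite_subset)
  \<comment> \<open>Both index sets are finite, so neither rank is \<open>\<infinity>\<close> and
    the equality is one of dimensions.\<close>
  have dim: "dim (matrix_columns I I M) = dim (matrix_columns J J M)"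
  proof -
    have "\<exists>C. finite C \<and> matrix_columns K K M \<subseteq> span C" if "finite K" for K
      using that by (intro exI[of _ "matrix_columns K K M"])
        (auto simp: matrix_columns_def intro: span_base)
    then show ?thesis
      using rank fin \<open>finite I\<close> by (simp add: matrix_rank_def)
  qed
  let ?C = "matrix_columns J I M"
  have res_image: "matrix_columns I I M = res ` ?C"
    using sub by (force simp: matrix_columns_def res_def image_image)
  have C_sub: "?C \<subseteq> matrix_columns J J M"
    using sub by (auto simp: matrix_columns_def)
  obtain B where B: "B \<subseteq> ?C" "independent B" "?C \<subseteq> span B" "card B = dim ?C"
    using real_vector.basis_exists by blast
  have finB: "finite B"
    using B(1) \<open>finite I\<close> by (auto simp: matrix_columns_def intro: finite_subset)
  obtain D where D: "D \<subseteq> matrix_columns J J M" "independent D"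
      "matrix_columns J J M \<subseteq> span D" "card D = dim (matrix_columns J J M)"
    using real_vector.basis_exists by blast
  have finD: "finite D"
    using D(1) fin by (auto simp: matrix_columns_def intro: finite_subset)
  have "matrix_columns I I M \<subseteq> span (res ` B)"
    unfolding res_image linear_span_image[OF lin_res] using B(3) by blast
  then have "dim (matrix_columns I I M) \<le> card (res ` B)"
    using finB by (intro real_vector.dim_le_card) auto
  also have "\<dots> \<le> card B"
    using finB by (rule card_image_le)
  finally have card: "card D \<le> card B"
    using dim D(4) by simp
  \<comment> \<open>A column outside \<open>span B\<close> would give \<open>card B + 1\<close>
    independent vectors in \<open>span D\<close>, although
    \<open>card D \<le> card B\<close>.\<close>
  have "x \<in> span B" if x: "x \<in> matrix_columns J J M" for x
  proof (rule ccontr)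
    assume nx: "x \<notin> span B"
    then have "independent (insert x B)"
      using B(2) real_vector.independent_insertI by blast
    moreover have "insert x B \<subseteq> span D"
      using x B(1) C_sub D(3) by blast
    ultimately have "card (insert x B) \<le> card D"
      using real_vector.independent_span_bound[OF finD] by blast
    moreover have "x \<notin> B"
      using nx span_base by blast
    ultimately show False
      using card finB by simp
  qed
  then show ?thesis
    using span_mono[OF B(1)] by blast
qed

text \<open>Flatness takes the form that every column of the moment matrix agrees with a combination
  of columns of degree at most \<open>d\<close>; \<open>u\<close> may replace its reversal since
  \<open>words\<close> is closed under \<open>rev\<close>. The assumption \<open>gap\<close> leaves
  room for one symbol on each side of a normal form.\<close>

locale flat_functional =
  fixes V :: "'g set" and r d :: nat and L :: "'g ncpoly \<Rightarrow> real"
  assumes lin: "linear L"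
    and sym: "symmetric_functional V (enat (2 * r)) L"
    and tracial: "tracial_functional V (enat (2 * r)) L"
    and flat: "w \<in> words V (enat r) \<Longrightarrow>
      \<exists>p\<in>ncpolys V (enat d). \<forall>u\<in>words V (enat r). L (mon u * mon w) = L (mon u * p)"
    and gap: "d + 2 \<le> r"
begin

abbreviation W :: "nat \<Rightarrow> 'g ncpoly set" where
  "W m \<equiv> ncpolys V (enat m)"

abbreviation Winf :: "'g ncpoly set" where
  "Winf \<equiv> ncpolys V \<infinity>"

lemma W_mono: "p \<in> W m \<Longrightarrow> m \<le> n \<Longrightarrow> p \<in> W n"
  by (rule ncpolys_enat_mono)

lemma Wd_sub: "p \<in> W d \<Longrightarrow> p \<in> W (r - 1)" "p \<in> W d \<Longrightarrow> p \<in> W r"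
  using W_mono[of p d "r - 1"] W_mono[of p d r] gap by auto

lemma symb_W: "v \<in> V \<Longrightarrow> mon [v] \<in> W (Suc 0)"
  by (simp add: mon_in_ncpolys_iff words_enat_iff)

lemma symb_mult_W:
  assumes "v \<in> V" "p \<in> W m" "Suc m \<le> n"
  shows "mon [v] * p \<in> W n" "p * mon [v] \<in> W n"
  using ncpolys_mult_enat[OF symb_W assms(2), of v n] ncpolys_mult_enat[OF assms(2) symb_W, of v n]
    assms by auto

lemmas L_simps = linear_add[OF lin] linear_diff[OF lin] linear_0[OF lin] linear_scale[OF lin]

section \<open>Traciality and the kernel of the moment matrix\<close>

lemma L_mult_commute:
  assumes p: "p \<in> W m" and q: "q \<in> W n" and deg: "m + n \<le> 2 * r"
  shows "L (p * q) = L (q * p)"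
proof -
  have words: "L (mon u * mon v) = L (mon v * mon u)"
    if "u \<in> words V (enat m)" "v \<in> words V (enat n)" for u v
  proof -
    have "u @ v \<in> words V (enat (2 * r))"
      using that deg by (auto simp: words_enat_iff)
    then show ?thesis
      using tracial by (auto simp: tracial_functional_def mon_mult)
  qed
  note left = linear_compose[OF linear_mult_left lin, unfolded o_def]
  note right = linear_compose[OF linear_mult_right lin, unfolded o_def]
  have "L (mon u * q) = L (q * mon u)" if "u \<in> words V (enat m)" for u
    by (rule linear_eq_on_ncpolys[OF left right _ q]) (use that words in auto)
  then show ?thesis
    by (intro linear_eq_on_ncpolys[OF right left _ p]) auto
qed

lemma L_ncstar: "p \<in> W (2 * r) \<Longrightarrow> L (ncstar p) = L p"
  by (rule linear_eq_on_ncpolys[OF linear_compose[OF linear_ncstar lin, unfolded o_def] lin])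
    (use sym in \<open>auto simp: symmetric_functional_def ncstar_mon\<close>)

text \<open>Pairing with \<open>q\<close> instead of \<open>ncstar q\<close> gives the same kernel,
  because \<open>W r\<close> is closed under the involution.\<close>

definition N :: "'g ncpoly set" where
  "N = {p \<in> W r. \<forall>q\<in>W r. L (q * p) = 0}"

lemma N_subspace: "linear_subspace N"
  by (rule linear_subspaceI) (auto simp: N_def ncpolys_simps L_simps distrib_left)

lemmas N_simps =
  real_vector.subspace_0[OF N_subspace]
  real_vector.subspace_add[OF N_subspace]
  real_vector.subspace_diff[OF N_subspace]
  real_vector.subspace_scale[OF N_subspace]

lemma N_imp_W: "p \<in> N \<Longrightarrow> p \<in> W r"
  by (simp add: N_def)

lemma NI:
  assumes "p \<in> W r" "\<And>u. u \<in> words V (enat r) \<Longrightarrow> L (mon u * p) = 0"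
  shows "p \<in> N"
proof -
  have "linear (\<lambda>q. L (q * p))"
    using linear_compose[OF linear_mult_right lin] by (simp add: o_def)
  then have "linear_subspace {q. L (q * p) \<in> {0}}"
    by (rule linear_preimage_subspace) (simp add: real_vector.subspace_def)
  then have "W r \<subseteq> {q. L (q * p) \<in> {0}}"
    by (rule ncpolys_subset_subspace) (use assms in auto)
  then show ?thesis
    using assms(1) by (auto simp: N_def)
qed

text \<open>The product of two polynomials of degree at most \<open>r\<close> is within reach of
  traciality, so a left kernel is also a right kernel.\<close>

lemma N_right_null: "p \<in> N \<Longrightarrow> q \<in> W r \<Longrightarrow> L (p * q) = 0"
  using L_mult_commute[of p r q r] by (simp add: N_def)

lemma N_trans: "p - q \<in> N \<Longrightarrow> q - s \<in> N \<Longrightarrow> p - s \<in> N"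
  using N_simps(2)[of "p - q" "q - s"] by simp

lemma N_sym: "p - q \<in> N \<Longrightarrow> q - p \<in> N"
  using N_simps(4)[of "p - q" "-1"] by simp

text \<open>For words this is the assumption \<open>flat\<close>; the polynomials that admit such a
  \<open>q\<close> form a subspace.\<close>

lemma flat_reduce:
  assumes "p \<in> W r"
  shows "\<exists>q\<in>W d. p - q \<in> N"
proof -
  let ?U = "{p. \<exists>q\<in>W d. p - q \<in> N}"
  have "linear_subspace ?U"
  proof (rule linear_subspaceI)
    show "0 \<in> ?U"
      using ncpolys_simps(1) N_simps(1) by force
  next
    fix p p' assume "p \<in> ?U" "p' \<in> ?U"
    then obtain q q' where "q \<in> W d" "p - q \<in> N" "q' \<in> W d" "p' - q' \<in> N"
      by auto
    then have "q + q' \<in> W d" "(p + p') - (q + q') \<in> N"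
      using N_simps(2)[of "p - q" "p' - q'"] by (simp_all add: ncpolys_simps algebra_simps)
    then show "p + p' \<in> ?U"
      by blast
  next
    fix c p assume "p \<in> ?U"
    then obtain q where "q \<in> W d" "p - q \<in> N"
      by auto
    then have "c *\<^sub>R q \<in> W d" "c *\<^sub>R p - c *\<^sub>R q \<in> N"
      using N_simps(4)[of "p - q" c] by (simp_all add: ncpolys_simps scaleR_diff_right)
    then show "c *\<^sub>R p \<in> ?U"
      by blast
  qed
  moreover have "mon w \<in> ?U" if w: "w \<in> words V (enat r)" for w
  proof -
    obtain q where q: "q \<in> W d" "\<forall>u\<in>words V (enat r). L (mon u * mon w) = L (mon u * q)"
      using flat[OF w] by blast
    have "mon w - q \<in> N"
      using q w Wd_sub by (intro NI) (auto simp: ncpolys_simps mon_in_ncpolys_iff L_simps right_diff_distrib)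
    with q(1) show ?thesis by blast
  qed
  ultimately show ?thesis
    using ncpolys_subset_subspace assms by blast
qed

text \<open>The bound \<open>r - 1\<close> is what later products with one symbol require.\<close>

lemma flat_split:
  assumes "p \<in> W r"
  obtains q n where "q \<in> W (r - 1)" "n \<in> N" "p = q + n"
proof -
  obtain q where "q \<in> W d" "p - q \<in> N"
    using flat_reduce[OF assms] by blast
  then show thesis
    using that[of q "p - q"] Wd_sub(1) by simp
qed

text \<open>A test polynomial \<open>q\<close> is replaced modulo \<open>N\<close> by
  \<open>q'\<close> of degree at most \<open>r - 1\<close>; the difference contributes nothing
  because \<open>N\<close> is a right kernel too. Then \<open>q' * mon [v]\<close> and
  \<open>mon [v] * q'\<close> are admissible test polynomials for \<open>p\<close>. The degree bound
  on \<open>p\<close> keeps the products in \<open>W r\<close>.\<close>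

lemma N_symb:
  assumes p: "p \<in> N" "p \<in> W (r - 1)" and v: "v \<in> V"
  shows "mon [v] * p \<in> N" "p * mon [v] \<in> N"
proof -
  have r: "Suc (r - 1) \<le> r" using gap by simp
  have vp: "mon [v] * p \<in> W r" and pv: "p * mon [v] \<in> W r"
    using symb_mult_W[OF v p(2) r] by auto
  have "L (q * (mon [v] * p)) = 0 \<and> L (q * (p * mon [v])) = 0" if qW: "q \<in> W r" for q
  proof -
    obtain q' n where q': "q' \<in> W (r - 1)" and n: "n \<in> N" and q: "q = q' + n"
      using flat_split[OF qW] .
    have vq: "mon [v] * q' \<in> W r" and qv: "q' * mon [v] \<in> W r"
      using symb_mult_W[OF v q' r] by auto
    \<comment> \<open>The cyclic shift happens in degree at most \<open>2 * r - 1\<close>, where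
      \<open>L\<close> is tracial.\<close>
    have "L (q' * p * mon [v]) = L (mon [v] * (q' * p))"
      using gap by (intro L_mult_commute[OF ncpolys_mult_enat[OF q' p(2) order_refl] symb_W[OF v]]) simp
    also have "\<dots> = 0"
      using p(1) vq by (simp add: N_def flip: mult.assoc)
    finally have "L (q' * (p * mon [v])) = 0"
      by (simp add: mult.assoc)
    moreover have "L (q' * (mon [v] * p)) = 0"
      using p(1) qv by (simp add: N_def flip: mult.assoc)
    ultimately show ?thesis
      using N_right_null[OF n vp] N_right_null[OF n pv] by (simp add: q distrib_right L_simps)
  qed
  then show "mon [v] * p \<in> N" "p * mon [v] \<in> N"
    using vp pv by (auto simp: N_def)
qed

text \<open>Symmetry of \<open>L\<close> exchanges left and right pairing with \<open>p\<close>, and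
  \<open>N\<close> is a kernel for both.\<close>

lemma N_ncstar:
  assumes "p \<in> N"
  shows "ncstar p \<in> N"
proof -
  have "L (q * ncstar p) = 0" if q: "q \<in> W r" for q
  proof -
    have "L (q * ncstar p) = L (ncstar (p * ncstar q))"
      by (simp add: ncstar_mult ncstar_ncstar)
    also have "\<dots> = L (p * ncstar q)"
      using N_imp_W[OF assms] ncstar_in_ncpolys[OF q]
      by (intro L_ncstar) (auto intro: ncpolys_mult_enat)
    finally show ?thesis
      using N_right_null[OF assms ncstar_in_ncpolys[OF q]] by simp
  qed
  then show ?thesis
    using N_imp_W[OF assms] ncstar_in_ncpolys by (auto simp: N_def)
qed

section \<open>Normal forms\<close>

definition red :: "'g ncpoly \<Rightarrow> 'g ncpoly" where
  "red p = (SOME q. q \<in> W d \<and> p - q \<in> N)"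

lemma red:
  assumes "p \<in> W r"
  shows "red p \<in> W d" "p - red p \<in> N"
  using someI_ex[of "\<lambda>q. q \<in> W d \<and> p - q \<in> N"] flat_reduce[OF assms] by (auto simp: red_def)

text \<open>\<^const>\<open>red\<close> is meaningful only on polynomials of degree at most \<open>r\<close>, so a word is
  reduced after each single multiplication.\<close>

definition nf :: "'g list \<Rightarrow> 'g ncpoly" where
  "nf w = foldr (\<lambda>v p. red (mon [v] * p)) w 1"

text \<open>\<open>red\<close> is an arbitrary choice of representative and need not be linear;
  linearity is imposed here by extending from words.\<close>

definition NF :: "'g ncpoly \<Rightarrow> 'g ncpoly" where
  "NF = lin_ext nf"

lemma nf_simps: "nf [] = 1" "nf (v # w) = red (mon [v] * nf w)"
  by (simp_all add: nf_def)

lemma NF_mon: "NF (mon w) = nf w"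
  by (simp add: NF_def lin_ext_mon)

lemma linear_NF: "linear NF"
  unfolding NF_def by (rule linear_lin_ext)

lemmas NF_simps = linear_add[OF linear_NF] linear_diff[OF linear_NF] linear_0[OF linear_NF]
  linear_scale[OF linear_NF]

lemma nf_W: "set w \<subseteq> V \<Longrightarrow> nf w \<in> W d"
proof (induction w)
  case (Cons v w)
  then have "mon [v] * nf w \<in> W r"
    using gap by (intro symb_mult_W(1)[of _ _ d]) auto
  then show ?case
    by (simp add: nf_simps red)
qed (simp add: nf_simps one_in_ncpolys)

lemma NF_W: "p \<in> Winf \<Longrightarrow> NF p \<in> W d"
  using ncpolys_subset_subspace[OF linear_preimage_subspace[OF linear_NF ncpolys_subspace], of V \<infinity> V "enat d"]
  by (auto simp: NF_mon nf_W words_infinity_iff)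

lemma N_linear_ext:
  assumes "linear f" "linear g" "\<And>w. w \<in> words V m \<Longrightarrow> f (mon w) - g (mon w) \<in> N"
    and "p \<in> ncpolys V m"
  shows "f p - g p \<in> N"
proof -
  have "linear_subspace {p. f p - g p \<in> N}"
    using linear_preimage_subspace[OF real_vector.module_hom_sub[OF assms(1,2)] N_subspace] .
  from ncpolys_subset_subspace[OF this, of V m] show ?thesis
    using assms(3,4) by auto
qed

text \<open>On words this is the recursion that defines \<open>nf\<close>; the rest is linear
  extension.\<close>

lemma NF_symb_left:
  assumes v: "v \<in> V" and p: "p \<in> Winf"
  shows "mon [v] * NF p - NF (mon [v] * p) \<in> N"
proof (rule N_linear_ext[OF _ _ _ p])
  show "linear (\<lambda>p. mon [v] * NF p)"
    using linear_compose[OF linear_NF linear_mult_left] by (simp add: o_def)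
  show "linear (\<lambda>p. NF (mon [v] * p))"
    using linear_compose[OF linear_mult_left linear_NF] by (simp add: o_def)
  fix w assume "w \<in> words V \<infinity>"
  then have "mon [v] * nf w \<in> W r"
    using gap v by (intro symb_mult_W[OF v nf_W]) (auto simp: words_infinity_iff)
  then show "mon [v] * NF (mon w) - NF (mon [v] * mon w) \<in> N"
    by (simp add: NF_mon mon_mult nf_simps red)
qed

text \<open>Induction on the word: the error for the tail has degree at most \<open>r - 1\<close>,
  so by \<open>N_symb\<close> it stays in \<open>N\<close> after multiplication by the next
  symbol.\<close>

lemma mon_nf: "w \<in> words V (enat r) \<Longrightarrow> mon w - nf w \<in> N"
proof (induction w)
  case Nil
  then show ?case by (simp add: nf_simps mon_Nil N_simps)
next
  case (Cons v w)
  then have v: "v \<in> V" and w: "w \<in> words V (enat (r - 1))" "w \<in> words V (enat r)"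
    by (auto simp: words_enat_iff)
  have "mon w - nf w \<in> W (r - 1)"
    using w Wd_sub nf_W by (auto simp: ncpolys_simps mon_in_ncpolys_iff words_enat_iff)
  from N_symb(1)[OF Cons.IH[OF w(2)] this v]
  have "mon [v] * mon w - mon [v] * nf w \<in> N"
    by (simp add: right_diff_distrib)
  moreover have "mon [v] * nf w - nf (v # w) \<in> N"
    using NF_symb_left[OF v, of "mon w"] w(2)
    by (simp add: NF_mon mon_mult mon_in_ncpolys_iff words_def)
  ultimately show ?case
    using N_trans by (simp add: mon_mult)
qed

lemma NF_small: "p \<in> W r \<Longrightarrow> p - NF p \<in> N"
  by (rule N_linear_ext[OF linear_id[unfolded id_def] linear_NF]) (auto simp: NF_mon mon_nf)

text \<open>Normal forms are built by left multiplication, so right multiplication needs an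
  argument. In the induction the outer symbols \<open>u\<close> and \<open>v\<close> act on
  different sides of \<open>nf w\<close>, and each congruence is multiplied by the other
  symbol.\<close>

lemma nf_snoc:
  assumes v: "v \<in> V"
  shows "set w \<subseteq> V \<Longrightarrow> nf (w @ [v]) - nf w * mon [v] \<in> N"
proof (induction w)
  case Nil
  have "[v] \<in> words V (enat r)"
    using v gap by (simp add: words_enat_iff)
  from N_sym[OF mon_nf[OF this]] show ?case
    by (simp add: nf_simps)
next
  case (Cons u w)
  then have u: "u \<in> V" and w: "set w \<subseteq> V" by auto
  have 1: "nf (u # (w @ [v])) - mon [u] * nf (w @ [v]) \<in> N"
    using N_sym[OF NF_symb_left[OF u, of "mon (w @ [v])"]] w v
    by (simp add: NF_mon mon_mult mon_in_ncpolys_iff words_def)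
  \<comment> \<open>Here the gap of two matters: a normal form times one symbol has degree at most
    \<open>r - 1\<close>, so \<open>N_symb\<close> allows a second symbol.\<close>
  have d: "Suc d \<le> r - 1" using gap by simp
  have "nf (w @ [v]) - nf w * mon [v] \<in> W (r - 1)"
    using w v by (intro ncpolys_simps(3) Wd_sub(1) nf_W symb_mult_W(2)[OF v nf_W[OF w] d]) auto
  from N_symb(1)[OF Cons.IH[OF w] this u]
  have 2: "mon [u] * nf (w @ [v]) - mon [u] * nf w * mon [v] \<in> N"
    by (simp add: right_diff_distrib mult.assoc)
  have "mon [u] * nf w - nf (u # w) \<in> N"
    using NF_symb_left[OF u, of "mon w"] w
    by (simp add: NF_mon mon_mult mon_in_ncpolys_iff words_def)
  moreover have "mon [u] * nf w - nf (u # w) \<in> W (r - 1)"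
    using w u by (intro ncpolys_simps(3) Wd_sub(1) nf_W symb_mult_W(1)[OF u nf_W[OF w] d]) auto
  ultimately have "(mon [u] * nf w - nf (u # w)) * mon [v] \<in> N"
    using N_symb(2)[OF _ _ v] by blast
  then have 3: "mon [u] * nf w * mon [v] - nf (u # w) * mon [v] \<in> N"
    by (simp add: left_diff_distrib)
  show ?case
    using N_trans[OF N_trans[OF 1 2] 3] by simp
qed

lemma NF_symb_right:
  assumes v: "v \<in> V" and p: "p \<in> Winf"
  shows "NF (p * mon [v]) - NF p * mon [v] \<in> N"
proof (rule N_linear_ext[OF _ _ _ p])
  show "linear (\<lambda>p. NF p * mon [v])"
    using linear_compose[OF linear_NF linear_mult_right] by (simp add: o_def)
  show "linear (\<lambda>p. NF (p * mon [v]))"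
    using linear_compose[OF linear_mult_right linear_NF] by (simp add: o_def)
  fix w assume "w \<in> words V \<infinity>"
  then show "NF (mon w * mon [v]) - NF (mon w) * mon [v] \<in> N"
    using nf_snoc[OF v] by (simp add: NF_mon mon_mult words_infinity_iff)
qed

section \<open>The two-sided null ideal\<close>

definition null_ideal :: "'g ncpoly set" where
  "null_ideal = {p \<in> Winf. NF p \<in> N}"

lemma null_ideal_subspace: "linear_subspace null_ideal"
  by (rule linear_subspaceI) (auto simp: null_ideal_def ncpolys_simps N_simps NF_simps)

lemmas null_ideal_simps =
  real_vector.subspace_0[OF null_ideal_subspace]
  real_vector.subspace_add[OF null_ideal_subspace]
  real_vector.subspace_diff[OF null_ideal_subspace]
  real_vector.subspace_scale[OF null_ideal_subspace]

text \<open>\<open>NF p\<close> has degree at most \<open>d\<close>, hence \<open>N_symb\<close>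
  applies to it, and \<open>NF_symb_left\<close> and \<open>NF_symb_right\<close> carry the result
  over to the normal form of the product.\<close>

lemma null_ideal_symb:
  assumes v: "v \<in> V" and p: "p \<in> null_ideal"
  shows "mon [v] * p \<in> null_ideal" "p * mon [v] \<in> null_ideal"
proof -
  have p': "p \<in> Winf" "NF p \<in> N" "NF p \<in> W (r - 1)"
    using p NF_W Wd_sub by (auto simp: null_ideal_def)
  have vW: "mon [v] \<in> Winf"
    using v by (simp add: mon_in_ncpolys_iff words_infinity_iff)
  have "NF (mon [v] * p) \<in> N"
    using N_simps(3)[OF N_symb(1)[OF p'(2,3) v] NF_symb_left[OF v p'(1)]] by simp
  then show "mon [v] * p \<in> null_ideal"
    using ncpolys_mult_infinity[OF vW p'(1)] by (simp add: null_ideal_def)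
  have "NF (p * mon [v]) \<in> N"
    using N_simps(2)[OF N_symb(2)[OF p'(2,3) v] NF_symb_right[OF v p'(1)]] by simp
  then show "p * mon [v] \<in> null_ideal"
    using ncpolys_mult_infinity[OF p'(1) vW] by (simp add: null_ideal_def)
qed

lemma null_ideal_mult:
  assumes p: "p \<in> null_ideal" and q: "q \<in> Winf"
  shows "q * p \<in> null_ideal" "p * q \<in> null_ideal"
proof -
  have left: "mon w * p \<in> null_ideal" if "set w \<subseteq> V" for w
    using that
  proof (induction w)
    case (Cons v w)
    then show ?case
      using null_ideal_symb(1)[of v "mon w * p"] by (simp add: mon_Cons[of v w] mult.assoc)
  qed (simp add: mon_Nil p)
  have right: "p * mon w \<in> null_ideal" if "set w \<subseteq> V" for w
    using that
  proof (induction w rule: rev_induct)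
    case (snoc v w)
    then show ?case
      using null_ideal_symb(2)[of v "p * mon w"] by (simp add: mult.assoc mon_mult)
  qed (simp add: mon_Nil p)
  have "Winf \<subseteq> {q. q * p \<in> null_ideal}"
    by (rule ncpolys_subset_subspace[OF linear_preimage_subspace[OF linear_mult_right null_ideal_subspace]])
      (simp add: left words_infinity_iff)
  moreover have "Winf \<subseteq> {q. p * q \<in> null_ideal}"
    by (rule ncpolys_subset_subspace[OF linear_preimage_subspace[OF linear_mult_left null_ideal_subspace]])
      (simp add: right words_infinity_iff)
  ultimately show "q * p \<in> null_ideal" "p * q \<in> null_ideal"
    using q by auto
qed

lemma N_imp_null_ideal:
  assumes "p \<in> N"
  shows "p \<in> null_ideal"
  using N_simps(3)[OF assms NF_small[OF N_imp_W[OF assms]]] ncpolys_infinity[OF N_imp_W[OF assms]]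
  by (simp add: null_ideal_def)

text \<open>\<open>NF_small\<close> applied to \<open>NF p\<close> shows that taking normal forms is
  idempotent modulo \<open>N\<close>.\<close>

lemma NF_cong:
  assumes "p \<in> Winf"
  shows "p - NF p \<in> null_ideal"
  using N_sym[OF NF_small[OF Wd_sub(2)[OF NF_W[OF assms]]]] N_sym assms ncpolys_infinity[OF NF_W[OF assms]]
  by (simp add: null_ideal_def ncpolys_simps NF_simps)

lemma null_ideal_mult_cong:
  assumes "p - p' \<in> null_ideal" "q - q' \<in> null_ideal" "p' \<in> Winf" "q \<in> Winf"
  shows "p * q - p' * q' \<in> null_ideal"
proof -
  have "(p - p') * q + p' * (q - q') \<in> null_ideal"
    using null_ideal_simps(2)[OF null_ideal_mult(2) null_ideal_mult(1)] assms by blast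
  then show ?thesis
    by (simp add: algebra_simps)
qed

section \<open>The extended functional\<close>

definition ext :: "'g ncpoly \<Rightarrow> real" where
  "ext p = L (NF p)"

lemma linear_ext: "linear ext"
  unfolding ext_def using linear_compose[OF linear_NF lin] by (simp add: o_def)

lemmas ext_simps = linear_add[OF linear_ext] linear_diff[OF linear_ext] linear_0[OF linear_ext]
  linear_scale[OF linear_ext]

lemma ext_null_ideal:
  assumes "p \<in> null_ideal"
  shows "ext p = 0"
proof -
  have "L (1 * NF p) = 0"
    using assms one_in_ncpolys[of V r] unfolding null_ideal_def N_def by blast
  then show ?thesis
    by (simp add: ext_def)
qed

lemma ext_cong: "p - q \<in> null_ideal \<Longrightarrow> ext p = ext q"
  using ext_null_ideal[of "p - q"] by (simp add: ext_simps)

text \<open>For a word \<open>p\<close>, its symbols are moved one at a time, from the right end,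
  into \<open>q\<close>. Replacing \<open>NF (mon [v] * q)\<close> by \<open>mon [v] * NF q\<close>
  is an error in \<open>N\<close>, which the remaining word annihilates under
  \<open>L\<close>.\<close>

lemma ext_mult_left:
  assumes p: "p \<in> W r" and q: "q \<in> Winf"
  shows "ext (p * q) = L (p * NF q)"
proof -
  have words: "ext (mon w * q) = L (mon w * NF q)" if "w \<in> words V (enat r)" "q \<in> Winf" for w q
    using that
  proof (induction w arbitrary: q rule: rev_induct)
    case Nil
    then show ?case by (simp add: mon_Nil ext_def)
  next
    case (snoc v w)
    then have v: "v \<in> V" and w: "w \<in> words V (enat r)"
      by (auto simp: words_enat_iff)
    have vq: "mon [v] * q \<in> Winf"
      using ncpolys_mult_infinity[OF ncpolys_infinity[OF symb_W[OF v]] snoc.prems(2)] .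
    have "ext (mon (w @ [v]) * q) = ext (mon w * (mon [v] * q))"
      by (simp add: mon_mult flip: mult.assoc)
    also have "\<dots> = L (mon w * NF (mon [v] * q))"
      using snoc.IH[OF w vq] .
    also have "\<dots> = L (mon w * (mon [v] * NF q))"
    proof -
      have "L (mon w * (mon [v] * NF q - NF (mon [v] * q))) = 0"
        using NF_symb_left[OF v snoc.prems(2)] w by (simp add: N_def mon_in_ncpolys_iff)
      then show ?thesis
        by (simp add: right_diff_distrib L_simps)
    qed
    finally show ?case
      by (simp add: mon_mult flip: mult.assoc)
  qed
  show ?thesis
    by (rule linear_eq_on_ncpolys[OF linear_compose[OF linear_mult_right linear_ext, unfolded o_def]
          linear_compose[OF linear_mult_right lin, unfolded o_def] _ p])
      (use words q in auto)
qed

text \<open>A word of length at most \<open>2 * r\<close> splits into halves of length at most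
  \<open>r\<close>: \<open>ext_mult_left\<close> treats the first, \<open>NF_small\<close> the
  second.\<close>

lemma ext_eq:
  assumes "p \<in> W (2 * r)"
  shows "ext p = L p"
proof (rule linear_eq_on_ncpolys[OF linear_ext lin _ assms])
  fix w assume w: "w \<in> words V (enat (2 * r))"
  let ?u = "take r w" and ?v = "drop r w"
  have u: "mon ?u \<in> W r" and v: "mon ?v \<in> W r"
    using w set_take_subset[of r w] set_drop_subset[of r w]
    by (auto simp: mon_in_ncpolys_iff words_enat_iff)
  have "L (mon ?u * (mon ?v - NF (mon ?v))) = 0"
    using NF_small[OF v] u by (simp add: N_def)
  then have "ext (mon ?u * mon ?v) = L (mon ?u * mon ?v)"
    using ext_mult_left[OF u ncpolys_infinity[OF v]] by (simp add: right_diff_distrib L_simps)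
  then show "ext (mon w) = L (mon w)"
    by (simp add: mon_mult)
qed

text \<open>Brings products of any degree down to degree \<open>2 * d\<close>, where the properties
  of \<open>L\<close> are available.\<close>

lemma ext_mult_NF:
  assumes "p \<in> Winf" "q \<in> Winf"
  shows "ext (p * q) = L (NF p * NF q)"
proof -
  have "ext (p * q) = ext (NF p * NF q)"
    using assms NF_cong ncpolys_infinity[OF NF_W] by (intro ext_cong null_ideal_mult_cong) auto
  also have "\<dots> = L (NF p * NF q)"
    using gap NF_W assms by (intro ext_eq ncpolys_mult_enat[of _ _ d _ d]) auto
  finally show ?thesis .
qed

lemma ext_mult_commute:
  assumes "p \<in> Winf" "q \<in> Winf"
  shows "ext (p * q) = ext (q * p)"
  using L_mult_commute[OF NF_W NF_W, of p q] assms gap by (simp add: ext_mult_NF)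

section \<open>Traciality, symmetry and positivity of the extension\<close>

lemma tracial_ext: "tracial_functional V \<infinity> ext"
proof -
  have "ext (mon (w @ w')) = ext (mon (w' @ w))" if "set (w @ w') \<subseteq> V" for w w'
    using ext_mult_commute[of "mon w" "mon w'"] that
    by (simp add: mon_in_ncpolys_iff words_infinity_iff mon_mult)
  then show ?thesis
    by (simp add: tracial_functional_def words_infinity_iff)
qed

text \<open>The involution turns the left multiplications that build \<open>nf\<close> into right
  multiplications, which \<open>nf_snoc\<close> handles.\<close>

lemma nf_rev: "set w \<subseteq> V \<Longrightarrow> nf (rev w) - ncstar (nf w) \<in> N"
proof (induction w)
  case Nil
  then show ?case
    using ncstar_mon[of "[] :: 'g list"] by (simp add: nf_simps mon_Nil N_simps)
next
  case (Cons v w)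
  then have v: "v \<in> V" and w: "set w \<subseteq> V" by auto
  have "nf (rev w) - ncstar (nf w) \<in> W (r - 1)"
    using w by (intro ncpolys_simps(3) Wd_sub(1) ncstar_in_ncpolys nf_W) auto
  from N_symb(2)[OF Cons.IH[OF w] this v]
  have "nf (rev w) * mon [v] - ncstar (mon [v] * nf w) \<in> N"
    by (simp add: left_diff_distrib ncstar_mult ncstar_mon)
  moreover have "nf (rev w @ [v]) - nf (rev w) * mon [v] \<in> N"
    using nf_snoc[OF v, of "rev w"] w by simp
  moreover have "ncstar (mon [v] * nf w) - ncstar (nf (v # w)) \<in> N"
    using N_ncstar[OF NF_symb_left[OF v, of "mon w"]] w
    by (simp add: linear_diff[OF linear_ncstar] NF_mon mon_mult mon_in_ncpolys_iff words_def)
  ultimately show ?case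
    using N_trans by (metis rev.simps(2))
qed

lemma symmetric_ext: "symmetric_functional V \<infinity> ext"
proof -
  have "ext (mon w) = ext (mon (rev w))" if w: "set w \<subseteq> V" for w
  proof -
    have "L (1 * (nf (rev w) - ncstar (nf w))) = 0"
      using nf_rev[OF w] one_in_ncpolys[of V r] unfolding N_def by blast
    then have "L (nf (rev w)) = L (ncstar (nf w))"
      by (simp add: L_simps)
    also have "\<dots> = L (nf w)"
      using gap by (intro L_ncstar W_mono[OF nf_W[OF w]]) simp
    finally show ?thesis
      by (simp add: ext_def NF_mon)
  qed
  note rev = this
  show ?thesis
    unfolding symmetric_functional_def by (intro ballI rev) (simp add: words_infinity_iff)
qed

lemma ncstar_cong:
  assumes p: "p \<in> Winf"
  shows "ncstar p - ncstar (NF p) \<in> null_ideal"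
proof -
  have "NF (ncstar p) - ncstar (NF p) \<in> N"
  proof (rule N_linear_ext[OF _ _ _ p])
    show "linear (\<lambda>p. NF (ncstar p))" "linear (\<lambda>p. ncstar (NF p))"
      using linear_compose[OF linear_ncstar linear_NF] linear_compose[OF linear_NF linear_ncstar]
      by (simp_all add: o_def)
  qed (simp add: ncstar_mon NF_mon nf_rev words_infinity_iff)
  from null_ideal_simps(2)[OF NF_cong[OF ncstar_in_ncpolys[OF p]] N_imp_null_ideal[OF this]]
  show ?thesis by simp
qed

text \<open>Once the outer factors are in normal form, the degree is at most
  \<open>2 * d + 1\<close>, where \<open>ext\<close> is \<open>L\<close>.\<close>

lemma ext_quadratic:
  assumes p: "p \<in> Winf" and g: "g \<in> W (Suc 0)"
  shows "ext (ncstar p * g * p) = L (ncstar (NF p) * g * NF p)"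
proof -
  have gW: "g \<in> Winf" and NFp: "NF p \<in> W d" "ncstar (NF p) \<in> W d" "ncstar p \<in> Winf"
    using g p NF_W ncstar_in_ncpolys ncpolys_infinity by auto
  have "ext (ncstar p * g * p) = ext (ncstar (NF p) * g * NF p)"
    using NFp ncpolys_infinity[OF NFp(1)] ncpolys_infinity[OF NFp(2)] p gW
    by (intro ext_cong null_ideal_mult_cong ncstar_cong NF_cong ncpolys_mult_infinity)
      (auto simp: null_ideal_simps)
  also have "\<dots> = L (ncstar (NF p) * g * NF p)"
    by (intro ext_eq ncpolys_mult_enat[OF ncpolys_mult_enat[OF NFp(2) g order_refl] NFp(1)])
      (use gap in simp)
  finally show ?thesis .
qed

text \<open>The polynomials on which \<open>ext\<close> is nonnegative form a convex cone, so
  generators suffice; replacing \<open>p\<close> by \<open>NF p\<close> turns a generator into one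
  of the truncated module.\<close>

lemma ext_quad_module_nonneg:
  assumes G: "G \<subseteq> W (Suc 0)"
    and pos: "\<And>p. p \<in> quad_module V (enat (2 * r)) G \<Longrightarrow> 0 \<le> L p"
    and q: "q \<in> quad_module V \<infinity> G"
  shows "0 \<le> ext q"
proof -
  have "convex_cone {p. 0 \<le> ext p}"
    by (auto simp: convex_cone_def convex_def conic_def ext_simps intro: exI[of _ 0])
  moreover have "0 \<le> ext (ncstar p * g * p)" if p: "p \<in> Winf" and "g \<in> G \<union> {1}" for p g
  proof -
    have g: "g \<in> W (Suc 0)"
      using that G one_in_ncpolys by auto
    have "ncstar (NF p) * g * NF p \<in> W (2 * r)"
      by (rule ncpolys_mult_enat[OF ncpolys_mult_enat[OF ncstar_in_ncpolys[OF NF_W[OF p]] g order_refl] NF_W[OF p]])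
        (use gap in simp)
    then have "ncstar (NF p) * g * NF p \<in> quad_module V (enat (2 * r)) G"
      unfolding quad_module_def using that ncpolys_infinity[OF NF_W[OF p]] by (intro hull_inc) blast
    then show ?thesis
      using pos ext_quadratic[OF p g] by simp
  qed
  ultimately have "quad_module V \<infinity> G \<subseteq> {p. 0 \<le> ext p}"
    unfolding quad_module_def by (intro hull_minimal) auto
  then show ?thesis using q by auto
qed

section \<open>Finite rank and membership in the null ideal\<close>

lemma null_idealI:
  assumes "h \<in> W r" "\<And>u. u \<in> words V (enat r) \<Longrightarrow> L (mon u * h) = 0"
  shows "h \<in> null_ideal"
  using N_imp_null_ideal[OF NI] assms by blast

text \<open>The column of a word equals that of its normal form, a combination of the finitely many
  columns indexed by words of length at most \<open>d\<close>.\<close>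

lemma moment_rank_ext:
  assumes "finite V"
  shows "moment_rank V \<infinity> ext < \<infinity>"
proof -
  \<comment> \<open>Columns are indexed by polynomials here, so that a normal form has a column and
    the dependence is linear.\<close>
  let ?C = "\<lambda>p :: 'g ncpoly. \<lambda>u. if u \<in> words V \<infinity> then ext (mon (rev u) * p) else 0"
  let ?B = "(\<lambda>w. ?C (mon w)) ` words V (enat d)"
  have "linear ?C"
    by (rule linearI) (auto simp: fun_eq_iff scaleR_fun_def distrib_left ext_simps)
  then have "linear_subspace {p. ?C p \<in> span ?B}"
    by (rule linear_preimage_subspace) (rule real_vector.subspace_span)
  then have "W d \<subseteq> {p. ?C p \<in> span ?B}"
    by (rule ncpolys_subset_subspace) (auto intro: span_base)
  moreover have "?C (mon w) = ?C (NF (mon w))" if w: "w \<in> words V \<infinity>" for w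
  proof -
    have "ext (mon (rev u) * mon w) = ext (mon (rev u) * NF (mon w))" if "u \<in> words V \<infinity>" for u
    proof (rule ext_cong)
      have "mon (rev u) * (mon w - NF (mon w)) \<in> null_ideal"
        using that w
        by (intro null_ideal_mult NF_cong) (auto simp: mon_in_ncpolys_iff words_infinity_iff)
      then show "mon (rev u) * mon w - mon (rev u) * NF (mon w) \<in> null_ideal"
        by (simp add: right_diff_distrib)
    qed
    then show ?thesis by auto
  qed
  ultimately have "?C (mon w) \<in> span ?B" if "w \<in> words V \<infinity>" for w
    using NF_W[of "mon w"] that by (auto simp: mon_in_ncpolys_iff)
  then have "matrix_columns (words V \<infinity>) (words V \<infinity>) (moment_matrix ext) \<subseteq> span ?B"
    unfolding matrix_columns_def moment_matrix_def mon_mult[symmetric] by blast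
  moreover have "finite ?B"
    using assms finite_words by blast
  ultimately show ?thesis
    unfolding moment_rank_def matrix_rank_def by auto
qed

text \<open>A membership test without a degree bound on \<open>p\<close>. Multipliers of degree at
  most \<open>d\<close> suffice, since a multiplier may be replaced by its normal form.\<close>

lemma null_idealI_ext:
  assumes p: "p \<in> Winf" and ext: "\<And>q. q \<in> W d \<Longrightarrow> ext (q * p) = 0"
  shows "p \<in> null_ideal"
proof -
  have "L (q * NF p) = 0" if q: "q \<in> W r" for q
  proof -
    have qW: "q \<in> Winf"
      using q by (rule ncpolys_infinity)
    have "L (q * NF p) = ext (q * p)"
      using ext_mult_left[OF q p] by simp
    also have "\<dots> = ext (NF q * p)"
      using null_ideal_mult(2)[OF NF_cong[OF qW] p] by (intro ext_cong) (simp add: left_diff_distrib)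
    finally show ?thesis
      using ext[OF NF_W[OF qW]] by simp
  qed
  then show ?thesis
    using p Wd_sub(2)[OF NF_W[OF p]] by (simp add: null_ideal_def N_def)
qed

text \<open>Modulo the ideal, \<open>u\<close> and \<open>v\<close> may be replaced by normal forms.
  The commutator then has degree at most \<open>2 * d + 3\<close>, and a multiplier of degree at
  most \<open>d\<close> brings this to \<open>3 * d + 3\<close>, still in the range where
  \<open>ext\<close> is \<open>L\<close>.\<close>

lemma null_ideal_corner_commutator:
  assumes z: "z \<in> V" and deg: "3 * d + 3 \<le> 2 * r"
    and comm: "\<And>x u v. x \<in> words V (enat d) \<Longrightarrow> u \<in> words V (enat d) \<Longrightarrow> v \<in> words V (enat d) \<Longrightarrow>
      L (mon x * (mon ([z] @ u @ [z] @ v @ [z]) - mon ([z] @ v @ [z] @ u @ [z]))) = 0"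
    and uv: "u \<in> words V \<infinity>" "v \<in> words V \<infinity>"
  shows "mon ([z] @ u @ [z] @ v @ [z]) - mon ([z] @ v @ [z] @ u @ [z]) \<in> null_ideal"
proof -
  define Z where "Z = mon [z]"
  have Z: "Z \<in> W (Suc 0)" "Z \<in> Winf"
    using symb_W[OF z] ncpolys_infinity by (auto simp: Z_def)
  define C where "C p q = Z * p * Z * q * Z" for p q
  have C_mon: "C (mon u) (mon v) = mon ([z] @ u @ [z] @ v @ [z])" for u v
    by (simp add: C_def Z_def mon_mult)
  have C_Winf: "C p q \<in> Winf" if "p \<in> Winf" "q \<in> Winf" for p q
    using that Z unfolding C_def by (intro ncpolys_mult_infinity)
  have C_cong: "C p q - C (NF p) (NF q) \<in> null_ideal" if pq: "p \<in> Winf" "q \<in> Winf" for p q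
  proof -
    have ZZ: "Z - Z \<in> null_ideal"
      by (simp add: null_ideal_simps)
    have NF: "NF p \<in> Winf" "NF q \<in> Winf"
      using pq NF_W ncpolys_infinity by blast+
    have 1: "Z * p - Z * NF p \<in> null_ideal"
      using null_ideal_mult_cong[OF ZZ NF_cong[OF pq(1)] Z(2) pq(1)] .
    have 2: "Z * p * Z - Z * NF p * Z \<in> null_ideal"
      by (rule null_ideal_mult_cong[OF 1 ZZ ncpolys_mult_infinity[OF Z(2) NF(1)] Z(2)])
    have 3: "Z * p * Z * q - Z * NF p * Z * NF q \<in> null_ideal"
      by (rule null_ideal_mult_cong[OF 2 NF_cong[OF pq(2)] _ pq(2)])
        (intro ncpolys_mult_infinity Z NF)
    show ?thesis
      unfolding C_def
      by (rule null_ideal_mult_cong[OF 3 ZZ _ Z(2)]) (intro ncpolys_mult_infinity Z NF)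
  qed
  have C_W: "q * C a b \<in> W (2 * r)" if "q \<in> W d" "a \<in> W d" "b \<in> W d" for q a b
  proof -
    have "Z * a \<in> W (Suc d)"
      by (rule ncpolys_mult_enat[OF Z(1) that(2)]) simp
    then have "Z * a * Z \<in> W (d + 2)"
      by (rule ncpolys_mult_enat[OF _ Z(1)]) simp
    then have "Z * a * Z * b \<in> W (2 * d + 2)"
      by (rule ncpolys_mult_enat[OF _ that(3)]) simp
    then have "C a b \<in> W (2 * d + 3)"
      unfolding C_def by (rule ncpolys_mult_enat[OF _ Z(1)]) simp
    then show ?thesis
      by (rule ncpolys_mult_enat[OF that(1)]) (use deg in simp)
  qed
  \<comment> \<open>\<open>?K\<close> is linear in each argument; \<open>K1\<close>,
    \<open>K2\<close> and \<open>K3\<close> pass from words to polynomials one argument at a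
    time.\<close>
  let ?K = "\<lambda>q a b. L (q * (C a b - C b a))"
  have lin1: "linear (\<lambda>q. ?K q a b)" and lin2: "linear (\<lambda>a. ?K q a b)"
    and lin3: "linear (\<lambda>b. ?K q a b)" for q a b
    by (rule linearI; simp add: C_def distrib_left distrib_right right_diff_distrib L_simps)+
  have zero: "linear (\<lambda>_ :: 'g ncpoly. 0 :: real)"
    by (rule linearI) auto
  have K1: "?K q (mon u) (mon v) = 0" if "q \<in> W d" "u \<in> words V (enat d)" "v \<in> words V (enat d)" for q u v
    by (rule linear_eq_on_ncpolys[OF lin1 zero _ that(1)]) (simp add: C_mon comm that(2,3) del: append.simps)
  have K2: "?K q a (mon v) = 0" if "q \<in> W d" "a \<in> W d" "v \<in> words V (enat d)" for q a v
    by (rule linear_eq_on_ncpolys[OF lin2 zero _ that(2)]) (rule K1[OF that(1) _ that(3)])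
  have K3: "?K q a b = 0" if "q \<in> W d" "a \<in> W d" "b \<in> W d" for q a b
    by (rule linear_eq_on_ncpolys[OF lin3 zero _ that(3)]) (rule K2[OF that(1,2)])
  define a b where "a = nf u" and "b = nf v"
  have ab: "a \<in> W d" "b \<in> W d"
    using uv nf_W by (auto simp: a_def b_def words_infinity_iff)
  have c0: "C a b - C b a \<in> null_ideal"
  proof (rule null_idealI_ext)
    show "C a b - C b a \<in> Winf"
      using C_Winf[of a b] C_Winf[of b a] ab[THEN ncpolys_infinity] by (simp add: ncpolys_simps)
    fix q assume q: "q \<in> W d"
    have "ext (q * (C a b - C b a)) = L (q * (C a b - C b a))"
      using C_W[OF q ab] C_W[OF q ab(2,1)] by (intro ext_eq) (simp add: right_diff_distrib ncpolys_simps)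
    then show "ext (q * (C a b - C b a)) = 0"
      using K3[OF q ab] by simp
  qed
  have c1: "C (mon u) (mon v) - C a b \<in> null_ideal"
    and c2: "C (mon v) (mon u) - C b a \<in> null_ideal"
    using C_cong[of "mon u" "mon v"] C_cong[of "mon v" "mon u"] uv
    by (simp_all add: a_def b_def NF_mon mon_in_ncpolys_iff)
  show ?thesis
    using null_ideal_simps(3)[OF null_ideal_simps(2)[OF c1 c0] c2] by (simp add: C_mon del: append.simps)
qed

end

text \<open>Translates equality of ranks into the assumption \<open>flat\<close> of the locale, via
  the span of the columns of degree at most \<open>d\<close>.\<close>

lemma flat_imp_reducible:
  assumes lin: "linear L" and fin: "finite V" and dr: "d \<le> r"
    and rank: "moment_rank V (enat d) L = moment_rank V (enat r) L"
    and w: "w \<in> words V (enat r)"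
  shows "\<exists>p\<in>ncpolys V (enat d). \<forall>u\<in>words V (enat r). L (mon u * mon w) = L (mon u * p)"
proof -
  let ?I = "words V (enat d)" and ?J = "words V (enat r)"
  \<comment> \<open>Only values on \<open>?J\<close> are constrained, so the zero padding in
    \<open>matrix_columns\<close> does no harm.\<close>
  let ?U = "{f. \<exists>p\<in>ncpolys V (enat d). \<forall>u\<in>?J. f u = L (mon (rev u) * p)}"
  have "linear_subspace ?U"
  proof (rule linear_subspaceI)
    show "0 \<in> ?U"
      using ncpolys_simps(1)[of V "enat d"] linear_0[OF lin] by (auto intro!: bexI[of _ 0])
  next
    fix f g assume "f \<in> ?U" "g \<in> ?U"
    then obtain p q where "p \<in> ncpolys V (enat d)" "q \<in> ncpolys V (enat d)"
        "\<forall>u\<in>?J. f u = L (mon (rev u) * p)" "\<forall>u\<in>?J. g u = L (mon (rev u) * q)"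
      by auto
    then show "f + g \<in> ?U"
      by (auto intro!: bexI[of _ "p + q"] simp: ncpolys_simps distrib_left linear_add[OF lin])
  next
    fix c f assume "f \<in> ?U"
    then obtain p where "p \<in> ncpolys V (enat d)" "\<forall>u\<in>?J. f u = L (mon (rev u) * p)"
      by auto
    then show "c *\<^sub>R f \<in> ?U"
      by (auto intro!: bexI[of _ "c *\<^sub>R p"] simp: ncpolys_simps scaleR_fun_def linear_scale[OF lin])
  qed
  moreover have "matrix_columns ?J ?I (moment_matrix L) \<subseteq> ?U"
    by (auto simp: matrix_columns_def moment_matrix_def mon_mult mon_in_ncpolys_iff
        intro!: bexI[of _ "mon _"])
  ultimately have "span (matrix_columns ?J ?I (moment_matrix L)) \<subseteq> ?U"
    by (intro span_minimal)
  moreover have "matrix_columns ?J ?J (moment_matrix L) \<subseteq> span (matrix_columns ?J ?I (moment_matrix L))"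
    using rank words_mono[of "enat d" "enat r" V] dr finite_words[OF fin]
    by (intro column_span_eq_if_rank_eq) (auto simp: moment_rank_def)
  ultimately have "(\<lambda>i. if i \<in> ?J then moment_matrix L i w else 0) \<in> ?U"
    using w unfolding matrix_columns_def by blast
  then obtain p where p: "p \<in> ncpolys V (enat d)"
      "\<forall>u\<in>?J. moment_matrix L u w = L (mon (rev u) * p)"
    by auto
  have "L (mon u * mon w) = L (mon u * p)" if "u \<in> ?J" for u
    \<comment> \<open>Row \<open>rev u\<close> of the moment matrix pairs with \<open>u\<close>
      itself.\<close>
    using p(2)[rule_format, of "rev u"] that
    by (simp add: moment_matrix_def mon_mult words_enat_iff)
  with p(1) show ?thesis by blast
qed

lemma moment_rank_cong:
  assumes "\<And>w. w \<in> words V (enat (2 * r)) \<Longrightarrow> L (mon w) = L' (mon w)" "m \<le> r"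
  shows "moment_rank V (enat m) L = moment_rank V (enat m) L'"
proof -
  have "rev u @ w \<in> words V (enat (2 * r))"
    if "u \<in> words V (enat m)" "w \<in> words V (enat m)" for u w
    using that assms(2) by (auto simp: words_enat_iff)
  then have "matrix_columns (words V (enat m)) (words V (enat m)) (moment_matrix L) =
      matrix_columns (words V (enat m)) (words V (enat m)) (moment_matrix L')"
    unfolding matrix_columns_def moment_matrix_def using assms(1)
    by (intro image_cong) (auto simp: fun_eq_iff)
  then show ?thesis
    by (simp add: moment_rank_def matrix_rank_def)
qed

section \<open>The hierarchy\<close>

lemma two_times_enat: "2 * enat r = enat (2 * r)"
  by (simp add: numeral_eq_enat)

lemma two_times_infinity: "2 * (\<infinity> :: enat) = \<infinity>"
  by (simp add: numeral_eq_enat)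

section \<open>Comparison of the orders of the hierarchy\<close>

lemma quad_module_subset: "quad_module V m G \<subseteq> ncpolys V m"
  unfolding quad_module_def
  by (rule hull_minimal) (auto intro: subspace_imp_convex_cone ncpolys_subspace)

lemma quad_module_mono: "m \<le> n \<Longrightarrow> quad_module V m G \<subseteq> quad_module V n G"
  unfolding quad_module_def using ncpolys_mono[of m n V] by (intro hull_mono) blast

lemma trunc_ideal_mono: "m \<le> n \<Longrightarrow> H \<subseteq> H' \<Longrightarrow> trunc_ideal V m H \<subseteq> trunc_ideal V n H'"
  unfolding trunc_ideal_def using ncpolys_mono[of m n V] by blast

lemma linear_imp_linear_functional_on: "linear L \<Longrightarrow> linear_functional_on U L"
  by (simp add: linear_functional_on_def linear_add linear_scale)

text \<open>Each constraint of order \<open>r\<close> is also one of order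
  \<open>\<infinity>\<close>, so the same functional works.\<close>

lemma xi_q_feasible_restrict:
  assumes L: "xi_q_feasible A B S T P \<infinity> L"
  shows "xi_q_feasible A B S T P (enat r) L"
proof -
  let ?V = "symbols A B S T"
  have le: "2 * enat r \<le> (\<infinity> :: enat)" by simp
  have W: "ncpolys ?V (2 * enat r) \<subseteq> ncpolys ?V \<infinity>" "words ?V (2 * enat r) \<subseteq> words ?V \<infinity>"
    using ncpolys_mono[OF le] words_mono[OF le] by auto
  have "set_R A B S T (enat r) \<subseteq> set_R A B S T \<infinity>"
    unfolding set_R_def by (auto simp: two_times_infinity)
  then have I: "trunc_ideal ?V (2 * enat r) (set_H A B S T \<union> set_R A B S T (enat r)) \<subseteq>
      trunc_ideal ?V \<infinity> (set_H A B S T \<union> set_R A B S T \<infinity>)"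
    by (intro trunc_ideal_mono) auto
  note M = quad_module_mono[OF le, of ?V "set_G A B S T"]
  have F: "linear_functional_on (ncpolys ?V \<infinity>) L" "symmetric_functional ?V \<infinity> L"
      "tracial_functional ?V \<infinity> L" "L (mon [Z]) = 1"
      "\<forall>a\<in>A. \<forall>b\<in>B. \<forall>s\<in>S. \<forall>t\<in>T. L (mon [X s a, Y t b, Z]) = P a b s t"
      "\<forall>p\<in>quad_module ?V \<infinity> (set_G A B S T). 0 \<le> L p"
      "\<forall>p\<in>trunc_ideal ?V \<infinity> (set_H A B S T \<union> set_R A B S T \<infinity>). L p = 0"
    using L by (simp_all add: xi_q_feasible_def two_times_infinity)
  show ?thesis
    unfolding xi_q_feasible_def
  proof (intro conjI impI)
    show "linear_functional_on (ncpolys ?V (2 * enat r)) L"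
      using F(1) W(1) unfolding linear_functional_on_def by blast
    show "symmetric_functional ?V (2 * enat r) L"
      using F(2) W(2) unfolding symmetric_functional_def by blast
    show "tracial_functional ?V (2 * enat r) L"
      using F(3) W(2) unfolding tracial_functional_def by blast
  qed (use F(4-7) I M in blast)+
qed

section \<open>Extension of a flat solution to all degrees\<close>

lemma set_H_subset:
  assumes "h \<in> set_H A B S T"
  shows "h \<in> ncpolys (symbols A B S T) (enat 2)"
proof -
  let ?W = "ncpolys (symbols A B S T) (enat 2)"
  have words: "mon w \<in> ?W" if "set w \<subseteq> symbols A B S T" "length w \<le> 2" for w
    using that by (simp add: mon_in_ncpolys_iff words_enat_iff)
  have "mon [Z] - mon [Z, Z] \<in> ?W"
    by (intro ncpolys_simps words) (auto simp: symbols_def)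
  moreover have "1 - (\<Sum>a\<in>A. mon [X s a]) \<in> ?W" if "s \<in> S" for s
    using that by (intro ncpolys_simps words one_in_ncpolys) (auto simp: symbols_def)
  moreover have "1 - (\<Sum>b\<in>B. mon [Y t b]) \<in> ?W" if "t \<in> T" for t
    using that by (intro ncpolys_simps words one_in_ncpolys) (auto simp: symbols_def)
  moreover have "mon [X s a, Y t b] - mon [Y t b, X s a] \<in> ?W"
    if "a \<in> A" "b \<in> B" "s \<in> S" "t \<in> T" for a b s t
    using that by (intro ncpolys_simps words) (auto simp: symbols_def)
  ultimately show ?thesis
    using assms by (auto simp: set_H_def mon_mult)
qed

lemma flat_feasible_extension:
  assumes fin: "finite A" "finite B" "finite S" "finite T"
    and L: "xi_q_feasible A B S T P (enat r) L"
    and flat: "delta_flat (symbols A B S T) r \<delta> L"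
    and \<delta>: "r + 3 \<le> 3 * \<delta>"
  shows "\<exists>L'. xi_q_star_feasible A B S T P L' \<and> L' 1 = L 1"
proof -
  define V where "V = symbols A B S T"
  define d where "d = r - \<delta>"
  have \<delta>r: "\<delta> \<le> r"
    using flat by (simp add: delta_flat_def)
  \<comment> \<open>From \<open>r + 3 \<le> 3 * \<delta>\<close> follows
    \<open>3 * d + 3 = 3 * r - 3 * \<delta> + 3 \<le> 2 * r\<close>. Together with
    \<open>\<delta> \<le> r\<close> it gives \<open>2 * \<delta> \<ge> 3\<close>, so
    \<open>\<delta> \<ge> 2\<close>, which yields the other two bounds.\<close>
  have r: "2 \<le> r" and gap: "d + 2 \<le> r" and deg: "3 * d + 3 \<le> 2 * r"
    using \<delta> \<delta>r by (auto simp: d_def)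
  have finV: "finite V"
  proof -
    have "V = (\<lambda>(s, a). X s a) ` (S \<times> A) \<union> (\<lambda>(t, b). Y t b) ` (T \<times> B) \<union> {Z}"
      by (auto simp: V_def symbols_def)
    then show ?thesis using fin by simp
  qed
  have ZV: "Z \<in> V"
    by (simp add: V_def symbols_def)
  let ?H = "set_H A B S T" and ?R = "set_R A B S T"
  have F: "linear_functional_on (ncpolys V (enat (2 * r))) L" "symmetric_functional V (enat (2 * r)) L"
      "tracial_functional V (enat (2 * r)) L" "L (mon [Z]) = 1"
      "\<And>p. p \<in> quad_module V (enat (2 * r)) (set_G A B S T) \<Longrightarrow> 0 \<le> L p"
      "\<And>p. p \<in> trunc_ideal V (enat (2 * r)) (?H \<union> ?R (enat r)) \<Longrightarrow> L p = 0"
    using L by (simp_all add: xi_q_feasible_def two_times_enat V_def)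
  \<comment> \<open>Since \<open>r \<ge> 2\<close>, the degree condition
    \<open>3 \<le> 2 * r\<close> holds and the correlation constraint is present.\<close>
  have FP: "L (mon [X s a, Y t b, Z]) = P a b s t" if "a \<in> A" "b \<in> B" "s \<in> S" "t \<in> T" for a b s t
    using L r that by (simp add: xi_q_feasible_def two_times_enat numeral_eq_enat)
  \<comment> \<open>\<open>L\<close> is arbitrary on polynomials of degree above \<open>2 * r\<close>; \<open>L0\<close> is linear everywhere.\<close>
  define L0 where "L0 = lin_ext (\<lambda>w. L (mon w))"
  have L0: "L0 p = L p" if "p \<in> ncpolys V (enat (2 * r))" for p
    unfolding L0_def by (rule lin_ext_functional[OF F(1) that])
  have L0_mon: "L0 (mon w) = L (mon w)" for w
    by (simp add: L0_def lin_ext_mon)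
  have lin: "linear L0"
    unfolding L0_def by (rule linear_lin_ext)
  have rank: "moment_rank V (enat d) L0 = moment_rank V (enat r) L0"
    using flat moment_rank_cong[of V r L0 L d] moment_rank_cong[of V r L0 L r] L0_mon gap
    by (simp add: delta_flat_def V_def d_def)
  interpret flat_functional V r d L0
  proof (rule flat_functional.intro)
    show "linear L0" by fact
    show "symmetric_functional V (enat (2 * r)) L0" "tracial_functional V (enat (2 * r)) L0"
      using F(2,3) by (simp_all add: symmetric_functional_def tracial_functional_def L0_mon)
    show "d + 2 \<le> r" by fact
  qed (use flat_imp_reducible[OF lin finV _ rank] gap in simp)
  have ext_L: "ext p = L p" if "p \<in> ncpolys V (enat (2 * r))" for p
    using ext_eq[OF that] L0[OF that] by simp
  \<comment> \<open>Elements of \<open>?H\<close> have degree at most \<open>2 \<le> r\<close> and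
    can be tested directly against words. The commutators have unbounded degree and go through their
    normal forms.\<close>
  have ideal: "h \<in> null_ideal" if h: "h \<in> ?H \<union> ?R \<infinity>" for h
    using h
  proof
    assume h: "h \<in> ?H"
    have hW: "h \<in> W 2"
      using set_H_subset[OF h] by (simp add: V_def)
    show ?thesis
    proof (rule null_idealI)
      show "h \<in> W r"
        using hW r by (rule W_mono)
      fix u assume u: "u \<in> words V (enat r)"
      then have uh: "mon u * h \<in> W (2 * r)"
        using r by (intro ncpolys_mult_enat[OF _ hW, of _ r]) (auto simp: mon_in_ncpolys_iff)
      have "mon u \<in> Winf"
        using u by (simp add: mon_in_ncpolys_iff words_def)
      then have "mon u * h \<in> trunc_ideal V (enat (2 * r)) (?H \<union> ?R (enat r))"
        using h uh unfolding trunc_ideal_def by blast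
      then show "L0 (mon u * h) = 0"
        using L0[OF uh] F(6) by simp
    qed
  next
    assume "h \<in> ?R \<infinity>"
    then obtain u v where uv: "u \<in> words V \<infinity>" "v \<in> words V \<infinity>"
      and h: "h = mon ([Z] @ u @ [Z] @ v @ [Z]) - mon ([Z] @ v @ [Z] @ u @ [Z])"
      unfolding set_R_def V_def by blast
    show ?thesis
      unfolding h
    proof (rule null_ideal_corner_commutator[OF ZV deg _ uv])
      fix x u v
      assume w: "x \<in> words V (enat d)" "u \<in> words V (enat d)" "v \<in> words V (enat d)"
      let ?h = "mon ([Z] @ u @ [Z] @ v @ [Z]) - mon ([Z] @ v @ [Z] @ u @ [Z])"
      have winf: "u \<in> words V \<infinity>" "v \<in> words V \<infinity>" and x: "mon x \<in> Winf"
        using w by (simp_all add: words_def mon_in_ncpolys_iff)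
      have "enat (length ([Z] @ u @ [Z] @ v @ [Z])) \<le> 2 * enat r"
        using w deg by (simp add: words_enat_iff two_times_enat)
      then have "?h \<in> ?R (enat r)"
        using winf unfolding set_R_def V_def by blast
      moreover have xh: "mon x * ?h \<in> W (2 * r)"
        unfolding right_diff_distrib mon_mult using w deg ZV
        by (intro ncpolys_simps) (auto simp: mon_in_ncpolys_iff words_enat_iff)
      ultimately have "mon x * ?h \<in> trunc_ideal V (enat (2 * r)) (?H \<union> ?R (enat r))"
        using x unfolding trunc_ideal_def by blast
      then show "L0 (mon x * ?h) = 0"
        using L0[OF xh] F(6) by simp
    qed
  qed
  have "xi_q_feasible A B S T P \<infinity> ext"
    unfolding xi_q_feasible_def two_times_infinity V_def[symmetric]
  proof (intro conjI impI ballI)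
    show "linear_functional_on Winf ext"
      using linear_ext by (rule linear_imp_linear_functional_on)
    show "symmetric_functional V \<infinity> ext" "tracial_functional V \<infinity> ext"
      by (rule symmetric_ext tracial_ext)+
    show "ext (mon [Z]) = 1"
      using F(4) r ZV by (subst ext_L) (auto simp: mon_in_ncpolys_iff words_enat_iff)
    show "ext (mon [X s a, Y t b, Z]) = P a b s t" if "a \<in> A" "b \<in> B" "s \<in> S" "t \<in> T" for a b s t
      using FP[OF that] r that
      by (subst ext_L) (auto simp: mon_in_ncpolys_iff words_enat_iff V_def symbols_def)
    show "0 \<le> ext p" if "p \<in> quad_module V \<infinity> (set_G A B S T)" for p
    proof (rule ext_quad_module_nonneg[OF _ _ that])
      show "set_G A B S T \<subseteq> W (Suc 0)"
        using symb_W by (auto simp: set_G_def V_def)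
      show "0 \<le> L0 p" if "p \<in> quad_module V (enat (2 * r)) (set_G A B S T)" for p
        using F(5)[OF that] L0 quad_module_subset that by fastforce
    qed
    show "ext p = 0" if p: "p \<in> trunc_ideal V \<infinity> (?H \<union> ?R \<infinity>)" for p
    proof -
      obtain q h where "q \<in> Winf" "h \<in> ?H \<union> ?R \<infinity>" "p = q * h"
        using p unfolding trunc_ideal_def by blast
      then show ?thesis
        using null_ideal_mult(1)[OF ideal] ext_null_ideal by simp
    qed
  qed
  moreover have "moment_rank (symbols A B S T) \<infinity> ext < \<infinity>"
    using moment_rank_ext[OF finV] by (simp add: V_def)
  moreover have "ext 1 = L 1"
    by (rule ext_L) (rule one_in_ncpolys)
  ultimately show ?thesis
    unfolding xi_q_star_feasible_def by blast
qed

theorem proposition2p10: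
  fixes A :: "'a set" and B :: "'b set" and S :: "'s set" and T :: "'t set"
    and P :: "'a \<Rightarrow> 'b \<Rightarrow> 's \<Rightarrow> 't \<Rightarrow> real" and r :: nat
  assumes "finite A" and "finite B" and "finite S" and "finite T"
    and "P \<in> C_q A B S T"
    and "\<exists>L. flat_optimal A B S T P r (nat \<lceil>real r / 3\<rceil> + 1) L"
  shows "xi_q A B S T P (enat r) = xi_q_star A B S T P"
proof (rule antisym)
  show "xi_q A B S T P (enat r) \<le> xi_q_star A B S T P"
    unfolding xi_q_def xi_q_star_def
    by (rule INF_superset_mono) (auto simp: xi_q_star_feasible_def xi_q_feasible_restrict)
next
  obtain L where L: "xi_q_feasible A B S T P (enat r) L"
    and opt: "\<And>L'. xi_q_feasible A B S T P (enat r) L' \<Longrightarrow> L 1 \<le> L' 1"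
    and flat: "delta_flat (symbols A B S T) r (nat \<lceil>real r / 3\<rceil> + 1) L"
    using assms(6) by (auto simp: flat_optimal_def)
  \<comment> \<open>Integer form of \<open>\<delta> \<ge> r/3 + 1\<close>.\<close>
  have "r + 3 \<le> 3 * (nat \<lceil>real r / 3\<rceil> + 1)"
  proof -
    define n where "n = nat \<lceil>real r / 3\<rceil>"
    have "real r / 3 \<le> real n"
      unfolding n_def by (rule real_nat_ceiling_ge)
    then have "r \<le> 3 * n"
      by linarith
    then show ?thesis
      by (simp add: n_def)
  qed
  then obtain L' where L': "xi_q_star_feasible A B S T P L'" "L' 1 = L 1"
    using flat_feasible_extension[OF assms(1-4) L flat] by blast
  have "xi_q_star A B S T P \<le> ereal (L 1)"
    unfolding xi_q_star_def using L' by (intro INF_lower2[of L']) auto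
  also have "\<dots> \<le> xi_q A B S T P (enat r)"
    unfolding xi_q_def using opt by (intro INF_greatest) auto
  finally show "xi_q_star A B S T P \<le> xi_q A B S T P (enat r)" .
qed

end
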